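(* The \textsc{Bi-clique Chain Completion} problem, parameterized by $k$, admits a kernel with $O(k^2)$ vertices: there is a polynomial-time algorithm that, given an instance $(G,k)$, outputs an equivalent instance $(G',k')$ with $k'\le k$ and $|V(G')|=O(k^2)$.
   Context: All graphs are finite, simple and undirected. A join in a graph is a bipartition $(X,Y)$ of its vertex set together with an order $x_1,\dots,x_{|X|}$ of $X$ such that $N_Y(x_i)\subseteq N_Y(x_{i+1})$ for all $i$. A bi-clique chain graph is a graph whose vertex set is partitioned into two cliques $(X,Y)$ forming a join. \textsc{Bi-clique Chain Completion}: given a graph $G=(V,E)$ and a positive integer $k$ (the parameter), decide whether there is a set $F\subseteq (V\times V)\setminus E$ with $|F|\le k$ such that $(V,E\cup F)$ is a bi-clique chain graph. Two instances are equivalent if one is a yes-instance iff the other is; a kernel with $h(k)$ vertices is an equivalent instance $(G',k')$, computed in polynomial time, with $k'\le k$ and $|V(G')|\le h(k)$. *)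

theory Defs
  imports Complex_Main "HOL-Library.Landau_Symbols" "HOL-Library.Log_Nat"
begin

type_synonym 'a ugraph = "'a set \<times> 'a set set"

abbreviation verts :: "'a ugraph \<Rightarrow> 'a set" where "verts G \<equiv> fst G"
abbreviation edges :: "'a ugraph \<Rightarrow> 'a set set" where "edges G \<equiv> snd G"

definition vertex_pairs :: "'a set \<Rightarrow> 'a set set" where
  "vertex_pairs V = {{u, v} | u v. u \<in> V \<and> v \<in> V \<and> u \<noteq> v}"

definition simple_graph :: "'a ugraph \<Rightarrow> bool" where
  "simple_graph G \<longleftrightarrow> finite (verts G) \<and> edges G \<subseteq> vertex_pairs (verts G)"

definition nbrs_in :: "'a ugraph \<Rightarrow> 'a set \<Rightarrow> 'a \<Rightarrow> 'a set" where
  "nbrs_in G Y x = {y \<in> Y. {x, y} \<in> edges G}"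

definition is_clique :: "'a ugraph \<Rightarrow> 'a set \<Rightarrow> bool" where
  "is_clique G X \<longleftrightarrow> X \<subseteq> verts G \<and> vertex_pairs X \<subseteq> edges G"

text \<open>A side of the bipartition may be empty; this only matters for graphs with at most one vertex.\<close>

definition is_join :: "'a ugraph \<Rightarrow> 'a set \<Rightarrow> 'a set \<Rightarrow> 'a list \<Rightarrow> bool" where
  "is_join G X Y xs \<longleftrightarrow>
     X \<union> Y = verts G \<and> X \<inter> Y = {} \<and> distinct xs \<and> set xs = X \<and>
     (\<forall>i. Suc i < length xs \<longrightarrow> nbrs_in G Y (xs ! i) \<subseteq> nbrs_in G Y (xs ! Suc i))"

definition biclique_chain_graph :: "'a ugraph \<Rightarrow> bool" where
  "biclique_chain_graph G \<longleftrightarrow> simple_graph G \<and>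
     (\<exists>X Y xs. is_clique G X \<and> is_clique G Y \<and> is_join G X Y xs)"

definition biclique_chain_completion :: "'a ugraph \<Rightarrow> nat \<Rightarrow> bool" where
  "biclique_chain_completion G k \<longleftrightarrow>
     (\<exists>F. F \<subseteq> vertex_pairs (verts G) - edges G \<and> card F \<le> k \<and>
          biclique_chain_graph (verts G, edges G \<union> F))"

text \<open>
  Model of computation: structured programs for a random access machine whose memory consists
  of named arrays of natural numbers; a scalar is an array used at index 0 only.  Only addition
  and truncated subtraction are primitive (no multiplication), so after \<open>t\<close> steps every number
  has at most \<open>O(t)\<close> bits more than the numbers of the input.  Hence the uniform cost measure
  used here is polynomially related to Turing machine time.  Expressions cost nothing on their
  own because their size is bounded by the program text.
\<close>

type_synonym vname = string
type_synonym state = "vname \<Rightarrow> nat \<Rightarrow> nat"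

datatype aexp = Const nat | Cell vname aexp | Add aexp aexp | Sub aexp aexp

datatype bexp = Less aexp aexp | Neg bexp | Conj bexp bexp

datatype com =
    Skip
  | Assign vname aexp aexp
  | Seq com com
  | Cond bexp com com
  | While bexp com

primrec aval :: "aexp \<Rightarrow> state \<Rightarrow> nat" where
  "aval (Const n) s = n"
| "aval (Cell x a) s = s x (aval a s)"
| "aval (Add a b) s = aval a s + aval b s"
| "aval (Sub a b) s = aval a s - aval b s"

primrec bval :: "bexp \<Rightarrow> state \<Rightarrow> bool" where
  "bval (Less a b) s \<longleftrightarrow> aval a s < aval b s"
| "bval (Neg b) s \<longleftrightarrow> \<not> bval b s"
| "bval (Conj b c) s \<longleftrightarrow> bval b s \<and> bval c s"

text \<open>\<open>exec p s t s'\<close>: started in \<open>s\<close>, program \<open>p\<close> halts in \<open>s'\<close> after \<open>t\<close> steps.\<close>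

inductive exec :: "com \<Rightarrow> state \<Rightarrow> nat \<Rightarrow> state \<Rightarrow> bool" where
  Skip: "exec Skip s 1 s"
| Assign: "exec (Assign x i a) s 1 (s(x := (s x)(aval i s := aval a s)))"
| Seq: "exec p s t s' \<Longrightarrow> exec q s' u s'' \<Longrightarrow> exec (Seq p q) s (t + u) s''"
| CondTrue: "bval b s \<Longrightarrow> exec p s t s' \<Longrightarrow> exec (Cond b p q) s (t + 1) s'"
| CondFalse: "\<not> bval b s \<Longrightarrow> exec q s t s' \<Longrightarrow> exec (Cond b p q) s (t + 1) s'"
| WhileFalse: "\<not> bval b s \<Longrightarrow> exec (While b p) s 1 s"
| WhileTrue: "bval b s \<Longrightarrow> exec p s t s' \<Longrightarrow> exec (While b p) s' u s'' \<Longrightarrow>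
    exec (While b p) s (t + u + 1) s''"

text \<open>
  An instance \<open>(G, k)\<close>, with the vertices of \<open>G\<close> numbered by the list \<open>vs\<close>, is stored as the
  number of vertices, the parameter, and the adjacency matrix in row-major order.
\<close>

definition stores :: "state \<Rightarrow> 'a ugraph \<Rightarrow> 'a list \<Rightarrow> nat \<Rightarrow> bool" where
  "stores s G vs k \<longleftrightarrow> distinct vs \<and> set vs = verts G \<and>
     s ''n'' 0 = length vs \<and> s ''k'' 0 = k \<and>
     (\<forall>i < length vs. \<forall>j < length vs.
        s ''adj'' (i * length vs + j) = (if {vs ! i, vs ! j} \<in> edges G then 1 else 0))"

definition clean :: "state \<Rightarrow> bool" where
  "clean s \<longleftrightarrow> (\<forall>x i. s x i \<noteq> 0 \<longrightarrow>
     x = ''n'' \<and> i = 0 \<or> x = ''k'' \<and> i = 0 \<or> x = ''adj'' \<and> i < s ''n'' 0 * s ''n'' 0)"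

text \<open>Bit length of the encoding, the parameter being written in binary.\<close>

definition inst_size :: "'a ugraph \<Rightarrow> nat \<Rightarrow> nat" where
  "inst_size G k = card (verts G) ^ 2 + floorlog 2 k"

text \<open>
  Vertices are natural numbers without loss of generality.  Memory is initially zero, so zero
  entries of the resulting matrix need not be written; the size of the result is therefore
  charged in addition to the number of steps.
\<close>

definition admits_kernel :: "(nat ugraph \<Rightarrow> nat \<Rightarrow> bool) \<Rightarrow> (nat \<Rightarrow> nat) \<Rightarrow> bool" where
  "admits_kernel P h \<longleftrightarrow>
     (\<exists>p c d. \<forall>G vs k s. simple_graph G \<and> 0 < k \<and> stores s G vs k \<and> clean s \<longrightarrow>
       (\<exists>t s' G' vs' k'.
          exec p s t s' \<and> stores s' G' vs' k' \<and>
          t + inst_size G' k' \<le> c * inst_size G k ^ d + c \<and>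
          simple_graph G' \<and> 0 < k' \<and>
          (P G k \<longleftrightarrow> P G' k') \<and> k' \<le> k \<and> card (verts G') \<le> h k))"

end

theory Submission imports Defs begin

text \<open>
  On the complement, the problem is to delete at most \<open>k\<close> edges so as to obtain a bipartite graph with nested
  neighbourhoods (a chain graph).  If an edge \<open>e\<close> and a vertex \<open>x\<close> are in conflict (see below), every solution
  not deleting \<open>e\<close> deletes an edge at \<open>x\<close>; hence an edge in conflict with more than \<open>2k\<close> vertices must be
  deleted.  A vertex may be removed if it has more than \<open>2k\<close> false twins, or if it is in conflict with no
  edge and has more than \<open>2k\<close> neighbours and more than \<open>2k\<close> vertices dominating its neighbourhood.

  Let \<open>F\<close> be a solution of an instance to which none of these rules applies.  At most \<open>2k\<close> vertices are
  touched by \<open>F\<close>, and at most \<open>2k\<^sup>2\<close> untouched ones are in conflict with some edge, which is then in \<open>F\<close>.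
  All other vertices have few neighbours or few dominators.  On each side the neighbourhoods of
  untouched vertices are nested, so \<open>(2k+1)\<^sup>2\<close> of them have few neighbours (at most \<open>2k+1\<close> sizes with at
  most \<open>2k+1\<close> twins each), and \<open>2k+1\<close> have few dominators.

  The rules are counting formulas over the adjacency matrix, so the program is obtained from a compiler
  for such formulas.
\<close>

section \<open>Deletion to chain graphs\<close>

text \<open>
  The set \<open>E\<close> consists of the non-edges of the input graph.  An isolated vertex of \<open>E\<close> fits on either side,
  so the vertex set plays no role, and the second condition is symmetric in the two sides.
\<close>

definition chain_edges :: "'a set set \<Rightarrow> bool" where
  "chain_edges E \<longleftrightarrow> (\<exists>X. (\<forall>u v. {u, v} \<in> E \<longrightarrow> (u \<in> X \<longleftrightarrow> v \<notin> X)) \<and>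
     (\<forall>a b c d. {a, b} \<in> E \<longrightarrow> {c, d} \<in> E \<longrightarrow> a \<in> X \<longrightarrow> c \<in> X \<longrightarrow> {a, d} \<in> E \<or> {c, b} \<in> E))"

definition chain_deletion :: "'a set set \<Rightarrow> nat \<Rightarrow> bool" where
  "chain_deletion E k \<longleftrightarrow> (\<exists>F \<subseteq> E. card F \<le> k \<and> chain_edges (E - F))"

definition nbh :: "'a set set \<Rightarrow> 'a \<Rightarrow> 'a set" where
  "nbh E x = {y. {x, y} \<in> E}"

definition del_vertex :: "'a set set \<Rightarrow> 'a \<Rightarrow> 'a set set" where
  "del_vertex E x = {e \<in> E. x \<notin> e}"

text \<open>
  For an edge \<open>zw\<close> this says that \<open>x\<close> completes it to a triangle, or is an end of an edge disjoint from
  and not joined to it, or is the vertex opposite to it in an induced 5-cycle.  In each case a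
  deletion set avoiding \<open>zw\<close> must contain an edge at \<open>x\<close>.
\<close>

definition conflict :: "'a set set \<Rightarrow> 'a \<Rightarrow> 'a \<Rightarrow> 'a \<Rightarrow> bool" where
  "conflict E z w x \<longleftrightarrow>
     {x, z} \<in> E \<and> {x, w} \<in> E \<or>
     {x, z} \<notin> E \<and> {x, w} \<notin> E \<and> (\<exists>y. {x, y} \<in> E \<and> {y, z} \<notin> E) \<and> (\<exists>y. {x, y} \<in> E \<and> {y, w} \<notin> E)"

definition twins :: "'a set set \<Rightarrow> 'a set \<Rightarrow> 'a \<Rightarrow> 'a set" where
  "twins E V x = {z \<in> V. z \<noteq> x \<and> nbh E x = nbh E z}"

definition dominators :: "'a set set \<Rightarrow> 'a set \<Rightarrow> 'a \<Rightarrow> 'a set" where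
  "dominators E V x = {z \<in> V. z \<noteq> x \<and> nbh E x \<subseteq> nbh E z}"

lemma mem_nbh [simp]: "y \<in> nbh E x \<longleftrightarrow> {x, y} \<in> E"
  by (simp add: nbh_def)

lemma finite_vertex_pairs [simp]:
  assumes "finite V" shows "finite (vertex_pairs V)"
proof -
  have "vertex_pairs V \<subseteq> Pow V" by (auto simp: vertex_pairs_def)
  then show ?thesis using assms by (meson finite_Pow_iff finite_subset)
qed

lemma vertex_pairs_iff [simp]:
  "{u, v} \<in> vertex_pairs V \<longleftrightarrow> u \<in> V \<and> v \<in> V \<and> u \<noteq> v"
  by (auto simp: vertex_pairs_def doubleton_eq_iff)

lemma vertex_pairs_edgeD:
  assumes "E \<subseteq> vertex_pairs V" "{u, v} \<in> E"
  shows "u \<in> V" "v \<in> V" "u \<noteq> v"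
  using subsetD[OF assms] by simp_all

lemma vertex_pairsE:
  assumes "e \<in> vertex_pairs V"
  obtains u v where "e = {u, v}" "u \<in> V" "v \<in> V" "u \<noteq> v"
  using assms by (auto simp: vertex_pairs_def)

lemma nbh_subset: "E \<subseteq> vertex_pairs V \<Longrightarrow> nbh E x \<subseteq> V"
  by (auto dest: vertex_pairs_edgeD)

lemma del_vertex_subset: "E \<subseteq> vertex_pairs V \<Longrightarrow> del_vertex E x \<subseteq> vertex_pairs (V - {x})"
  unfolding del_vertex_def vertex_pairs_def by blast

lemma del_vertex_iff: "{u, v} \<in> del_vertex E x \<longleftrightarrow> {u, v} \<in> E \<and> u \<noteq> x \<and> v \<noteq> x"
  by (auto simp: del_vertex_def)

lemma chain_edges_vimage:
  assumes "chain_edges E'" "\<And>a b. {a, b} \<in> E \<longleftrightarrow> {f a, f b} \<in> E'"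
  shows "chain_edges E"
proof -
  obtain X where X: "\<And>u v. {u, v} \<in> E' \<Longrightarrow> u \<in> X \<longleftrightarrow> v \<notin> X"
    "\<And>a b c d. {a, b} \<in> E' \<Longrightarrow> {c, d} \<in> E' \<Longrightarrow> a \<in> X \<Longrightarrow> c \<in> X \<Longrightarrow> {a, d} \<in> E' \<or> {c, b} \<in> E'"
    using assms(1) unfolding chain_edges_def by blast
  show ?thesis unfolding chain_edges_def
    by (rule exI[of _ "f -` X"]) (auto simp: assms(2) dest: X)
qed

lemma chain_edges_del_vertex:
  assumes "chain_edges E" shows "chain_edges (del_vertex E x)"
proof -
  obtain X where X: "\<And>u v. {u, v} \<in> E \<Longrightarrow> u \<in> X \<longleftrightarrow> v \<notin> X"
    "\<And>a b c d. {a, b} \<in> E \<Longrightarrow> {c, d} \<in> E \<Longrightarrow> a \<in> X \<Longrightarrow> c \<in> X \<Longrightarrow> {a, d} \<in> E \<or> {c, b} \<in> E"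
    using assms unfolding chain_edges_def by blast
  show ?thesis unfolding chain_edges_def del_vertex_iff
    by (rule exI[of _ X]) (use X in blast)
qed

lemma chain_deletion_del_vertex:
  assumes "finite E" "chain_deletion E k" shows "chain_deletion (del_vertex E x) k"
proof -
  obtain F where F: "F \<subseteq> E" "card F \<le> k" "chain_edges (E - F)"
    using assms(2) unfolding chain_deletion_def by blast
  have "del_vertex (E - F) x = del_vertex E x - del_vertex F x"
    by (auto simp: del_vertex_def)
  moreover have "card (del_vertex F x) \<le> card F"
    using F(1) assms(1) by (intro card_mono) (auto simp: del_vertex_def finite_subset)
  moreover have "del_vertex F x \<subseteq> del_vertex E x" using F(1) by (auto simp: del_vertex_def)
  ultimately show ?thesis unfolding chain_deletion_def
    using chain_edges_del_vertex[OF F(3), of x] F(2) by (intro exI[of _ "del_vertex F x"]) auto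
qed

lemma card_Union_pairs:
  assumes "F \<subseteq> vertex_pairs V" "finite V"
  shows "card (\<Union>F) \<le> 2 * card F"
proof -
  have "card (\<Union>F) \<le> (\<Sum>e\<in>F. card e)"
    by (rule card_Union_le_sum_card)
  also have "\<dots> \<le> (\<Sum>e\<in>F. 2)"
    by (rule sum_mono) (use assms(1) in \<open>auto elim!: vertex_pairsE[OF subsetD] simp: card_insert_if\<close>)
  finally show ?thesis by simp
qed

lemma exists_untouched:
  assumes "F \<subseteq> vertex_pairs V" "finite V" "card F \<le> k" "2 * k < card T"
  obtains t where "t \<in> T" "t \<notin> \<Union>F"
proof -
  have "finite (\<Union>F)"
    using assms(1,2) by (intro finite_subset[of "\<Union>F" V]) (auto simp: vertex_pairs_def)
  moreover have "card (\<Union>F) < card T" using card_Union_pairs[OF assms(1,2)] assms(3,4) by linarith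
  ultimately have "\<not> T \<subseteq> \<Union>F" using card_mono leD by blast
  then show ?thesis using that by blast
qed

lemma conflict_deletion:
  assumes "chain_edges (E - F)" "{z, w} \<in> E" "conflict E z w x"
  shows "{z, w} \<in> F \<or> x \<in> \<Union>F"
proof (rule ccontr)
  assume "\<not> ?thesis"
  then have zw: "{z, w} \<in> E - F" and x: "\<And>y. {x, y} \<notin> F" using assms(2) by auto
  obtain X where X: "\<And>u v. {u, v} \<in> E - F \<Longrightarrow> u \<in> X \<longleftrightarrow> v \<notin> X"
    "\<And>a b c d. {a, b} \<in> E - F \<Longrightarrow> {c, d} \<in> E - F \<Longrightarrow> a \<in> X \<Longrightarrow> c \<in> X \<Longrightarrow>
      {a, d} \<in> E - F \<or> {c, b} \<in> E - F"
    using assms(1) unfolding chain_edges_def by blast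
  consider "{x, z} \<in> E" "{x, w} \<in> E"
    | y y' where "{x, z} \<notin> E" "{x, w} \<notin> E" "{x, y} \<in> E" "{y, z} \<notin> E" "{x, y'} \<in> E" "{y', w} \<notin> E"
    using assms(3) unfolding conflict_def by blast
  then show False
  proof cases
    case 1
    then show False using X(1)[of x z] X(1)[of x w] X(1)[OF zw] x by auto
  next
    case 2
    note E2 = 2
    have xy: "{x, y} \<in> E - F" "{x, y'} \<in> E - F" using E2 x by auto
    have yx: "{y, x} \<in> E - F" "{y', x} \<in> E - F" using xy by (simp_all add: insert_commute)
    have wz: "{w, z} \<in> E - F" using zw by (simp add: insert_commute)
    note c = X(1)[OF zw] X(1)[OF xy(1)] X(1)[OF xy(2)]
    have n: "{z, y} \<notin> E" "{w, y'} \<notin> E" "{z, x} \<notin> E" "{w, x} \<notin> E"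
      using E2 by (simp_all add: insert_commute)
    show False
      using c X(2)[OF zw xy(1)] X(2)[OF wz xy(2)] X(2)[OF zw yx(2)] X(2)[OF wz yx(1)] n E2 by blast
  qed
qed

lemma chain_deletion_forced:
  assumes E: "E \<subseteq> vertex_pairs V" "finite V" and e: "{z, w} \<in> E"
    and many: "2 * k < card {x \<in> V. conflict E z w x}"
  shows "chain_deletion E k \<longleftrightarrow> 0 < k \<and> chain_deletion (E - {{z, w}}) (k - 1)"
proof
  have finE: "finite E" using E finite_subset finite_vertex_pairs by metis
  assume "chain_deletion E k"
  then obtain F where F: "F \<subseteq> E" "card F \<le> k" "chain_edges (E - F)"
    unfolding chain_deletion_def by blast
  have finF: "finite F" using F(1) finE finite_subset by blast
  obtain x where "conflict E z w x" "x \<notin> \<Union>F"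
    using exists_untouched[OF subset_trans[OF F(1) E(1)] E(2) F(2) many] by blast
  then have eF: "{z, w} \<in> F" using conflict_deletion[OF F(3) e] by blast
  then have "0 < card F" using finF card_gt_0_iff by blast
  moreover have "card (F - {{z, w}}) \<le> k - 1" using eF finF F(2) by simp
  moreover have "E - {{z, w}} - (F - {{z, w}}) = E - F" using eF by blast
  ultimately show "0 < k \<and> chain_deletion (E - {{z, w}}) (k - 1)"
    unfolding chain_deletion_def using F by (intro conjI exI[of _ "F - {{z, w}}"]) auto
next
  assume "0 < k \<and> chain_deletion (E - {{z, w}}) (k - 1)"
  then obtain F where F: "0 < k" "F \<subseteq> E - {{z, w}}" "card F \<le> k - 1" "chain_edges (E - {{z, w}} - F)"
    unfolding chain_deletion_def by blast
  moreover have "E - {{z, w}} - F = E - insert {z, w} F" by blast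
  moreover have "card (insert {z, w} F) \<le> k" by (rule card_insert_le_m1[OF F(1,3)])
  ultimately show "chain_deletion E k"
    unfolding chain_deletion_def using e by (intro exI[of _ "insert {z, w} F"]) auto
qed

lemma chain_deletion_twin:
  assumes E: "E \<subseteq> vertex_pairs V" "finite V" and many: "2 * k < card (twins E V x)"
  shows "chain_deletion E k \<longleftrightarrow> chain_deletion (del_vertex E x) k"
proof
  assume "chain_deletion (del_vertex E x) k"
  then obtain F where F: "F \<subseteq> del_vertex E x" "card F \<le> k" "chain_edges (del_vertex E x - F)"
    unfolding chain_deletion_def by blast
  have FE: "F \<subseteq> E" and xF: "x \<notin> \<Union>F" using F(1) by (auto simp: del_vertex_def)
  obtain t where t: "t \<in> twins E V x" "t \<notin> \<Union>F"
    using exists_untouched[OF subset_trans[OF FE E(1)] E(2) F(2) many] .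
  then have tx: "t \<noteq> x" and tw: "\<And>y. {x, y} \<in> E \<longleftrightarrow> {t, y} \<in> E"
    by (auto simp: twins_def nbh_def set_eq_iff)
  have tw': "\<And>y. {y, x} \<in> E \<longleftrightarrow> {y, t} \<in> E" using tw by (simp add: insert_commute)
  have ir: "{t, t} \<notin> E" "{x, x} \<notin> E" "{t, x} \<notin> E" "{x, t} \<notin> E"
    using vertex_pairs_edgeD(3)[OF E(1), of t t] vertex_pairs_edgeD(3)[OF E(1), of x x]
      tw[of t] tw'[of t] tw'[of x] by auto
  have nF: "{x, y} \<notin> F" "{y, x} \<notin> F" "{t, y} \<notin> F" "{y, t} \<notin> F" for y using xF t(2) by auto
  have "chain_edges (E - F)"
  proof (rule chain_edges_vimage[OF F(3), where f = "\<lambda>v. if v = x then t else v"])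
    fix a b
    show "{a, b} \<in> E - F \<longleftrightarrow>
      {if a = x then t else a, if b = x then t else b} \<in> del_vertex E x - F"
      using tw tw' ir nF tx by (cases "a = x"; cases "b = x") (auto simp: del_vertex_def)
  qed
  then show "chain_deletion E k" unfolding chain_deletion_def using FE F(2) by blast
next
  show "chain_deletion E k \<Longrightarrow> chain_deletion (del_vertex E x) k"
    using chain_deletion_del_vertex E finite_subset finite_vertex_pairs by metis
qed

lemma chain_edges_side:
  assumes "chain_edges E"
  obtains X where "\<And>u v. {u, v} \<in> E \<Longrightarrow> u \<in> X \<longleftrightarrow> v \<notin> X"
    "\<And>a b c d. {a, b} \<in> E \<Longrightarrow> {c, d} \<in> E \<Longrightarrow> a \<in> X \<Longrightarrow> c \<in> X \<Longrightarrow> {a, d} \<in> E \<or> {c, b} \<in> E"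
    "v \<in> X"
proof -
  obtain X where X: "\<And>u v. {u, v} \<in> E \<Longrightarrow> u \<in> X \<longleftrightarrow> v \<notin> X"
    "\<And>a b c d. {a, b} \<in> E \<Longrightarrow> {c, d} \<in> E \<Longrightarrow> a \<in> X \<Longrightarrow> c \<in> X \<Longrightarrow> {a, d} \<in> E \<or> {c, b} \<in> E"
    using assms unfolding chain_edges_def by blast
  show ?thesis
  proof (cases "v \<in> X")
    case True
    then show ?thesis using that X by blast
  next
    case False
    show ?thesis
    proof (rule that[of "- X"])
      fix a b c d assume *: "{a, b} \<in> E" "{c, d} \<in> E" "a \<in> - X" "c \<in> - X"
      then have "{b, a} \<in> E" "{d, c} \<in> E" by (simp_all add: insert_commute)
      moreover have "b \<in> X" "d \<in> X" using * X(1) by blast+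
      ultimately have "{b, c} \<in> E \<or> {d, a} \<in> E" using X(2) by blast
      then show "{a, d} \<in> E \<or> {c, b} \<in> E" by (auto simp: insert_commute)
    qed (use X False in auto)
  qed
qed

text \<open>
  Conflict-freeness of \<open>x\<close> means that \<open>N = nbh E x\<close> is independent and that every edge outside
  \<open>N \<union> {x}\<close> has an end in the set \<open>C\<close> of dominators.  Untouched vertices of \<open>N\<close> and \<open>C\<close> force \<open>C\<close> and
  \<open>N\<close> to lie on opposite sides, and then all deleted edges between \<open>C\<close> and \<open>N\<close> can be put back.
\<close>

lemma chain_deletion_conflict_free:
  assumes E: "E \<subseteq> vertex_pairs V" "finite V"
    and free: "\<And>z w. {z, w} \<in> E \<Longrightarrow> \<not> conflict E z w x"
    and manyN: "2 * k < card (nbh E x)" and manyC: "2 * k < card (dominators E V x)"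
  shows "chain_deletion E k \<longleftrightarrow> chain_deletion (del_vertex E x) k"
proof
  define N C where "N = nbh E x" and "C = dominators E V x"
  assume "chain_deletion (del_vertex E x) k"
  then obtain F where F: "F \<subseteq> del_vertex E x" "card F \<le> k" "chain_edges (del_vertex E x - F)"
    unfolding chain_deletion_def by blast
  have FE: "F \<subseteq> E" and xF: "\<And>y. {x, y} \<notin> F" using F(1) by (auto simp: del_vertex_def)
  have finF: "finite F" using FE E finite_subset finite_vertex_pairs by metis
  obtain y0 where y0: "y0 \<in> N" "y0 \<notin> \<Union>F"
    using exists_untouched[OF subset_trans[OF FE E(1)] E(2) F(2) manyN] N_def by blast
  obtain c0 where c0: "c0 \<in> C" "c0 \<notin> \<Union>F"
    using exists_untouched[OF subset_trans[OF FE E(1)] E(2) F(2) manyC] C_def by blast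
  define E' where "E' = del_vertex E x - F"
  obtain X where X: "\<And>u v. {u, v} \<in> E' \<Longrightarrow> u \<in> X \<longleftrightarrow> v \<notin> X"
    "\<And>a b c d. {a, b} \<in> E' \<Longrightarrow> {c, d} \<in> E' \<Longrightarrow> a \<in> X \<Longrightarrow> c \<in> X \<Longrightarrow> {a, d} \<in> E' \<or> {c, b} \<in> E'"
    and c0X: "c0 \<in> X"
    using chain_edges_side[OF F(3), of c0] unfolding E'_def by blast
  have xN: "x \<notin> N" using vertex_pairs_edgeD(3)[OF E(1), of x x] by (auto simp: N_def)
  have xC: "x \<notin> C" by (auto simp: C_def dominators_def)
  have CN: "{c, y} \<in> E" if "c \<in> C" "y \<in> N" for c y
    using that by (auto simp: C_def N_def dominators_def)
  have CN': "{c, y} \<in> del_vertex E x" if "c \<in> C" "y \<in> N" for c y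
    using CN[OF that] that xN xC by (auto simp: del_vertex_iff)
  have NX: "y \<notin> X" if "y \<in> N" for y
  proof -
    have "{c0, y} \<in> E'" using CN'[OF c0(1) that] c0(2) by (auto simp: E'_def)
    then show ?thesis using X(1) c0X by blast
  qed
  have CX: "c \<in> X" if "c \<in> C" for c
  proof -
    have "{c, y0} \<in> E'" using CN'[OF that y0(1)] y0(2) by (auto simp: E'_def)
    then show ?thesis using X(1) NX y0(1) by blast
  qed
  have cover: "z \<in> C \<or> w \<in> C" if "{z, w} \<in> E" "z \<notin> N" "w \<notin> N" "z \<noteq> x" "w \<noteq> x" for z w
    using free[OF that(1)] that vertex_pairs_edgeD[OF E(1) that(1)]
    unfolding conflict_def C_def N_def dominators_def nbh_def by (auto simp: insert_commute)
  define P where "P = {{c, y} | c y. c \<in> C \<and> y \<in> N}"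
  define E2 where "E2 = E - (F - P)"
  define X2 where "X2 = insert x X"
  have E'E2: "E' \<subseteq> E2" by (auto simp: E'_def E2_def del_vertex_def)
  have col: "u \<in> X2 \<longleftrightarrow> v \<notin> X2" if E2uv: "{u, v} \<in> E2" for u v
  proof -
    have uv: "{u, v} \<in> E" "u \<noteq> v" using E2uv vertex_pairs_edgeD(3)[OF E(1)] by (auto simp: E2_def)
    consider "u = x" | "v = x" | "{u, v} \<in> E'" "u \<noteq> x" "v \<noteq> x" | "{u, v} \<in> P"
      using E2uv uv unfolding E2_def E'_def del_vertex_iff Diff_iff by blast
    then show ?thesis
    proof cases
      case 1
      then have "v \<in> N" using uv by (simp add: N_def)
      then show ?thesis using 1 uv NX by (auto simp: X2_def)
    next
      case 2
      then have "u \<in> N" using uv by (simp add: N_def insert_commute)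
      then show ?thesis using 2 uv NX by (auto simp: X2_def)
    next
      case 3
      then show ?thesis using X(1) by (auto simp: X2_def)
    next
      case 4
      then show ?thesis using CX NX xN xC by (auto simp: P_def X2_def doubleton_eq_iff)
    qed
  qed
  have full: "{a, d} \<in> E2" if "a \<in> C \<or> a = x" "d \<in> N" for a d
    using that CN xF by (auto simp: E2_def P_def N_def)
  have side: "(a \<in> C \<or> a = x) \<or> b \<in> N" if "{a, b} \<in> E2" "a \<in> X2" for a b
  proof (rule ccontr)
    assume n: "\<not> ?thesis"
    have "b \<notin> X2" using col that by blast
    moreover have "a \<notin> N" using that(2) NX xN by (auto simp: X2_def)
    ultimately show False using cover[of a b] n that CX by (auto simp: E2_def X2_def)
  qed
  have inE': "{a, b} \<in> E'" if "{a, b} \<in> E2" "a \<in> X2" "(a \<in> C \<or> a = x) \<longleftrightarrow> b \<notin> N" for a b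
  proof -
    have bX: "b \<notin> X2" using col that by blast
    have "a \<noteq> x" using that by (auto simp: E2_def N_def)
    moreover have "{a, b} \<notin> P"
    proof
      assume "{a, b} \<in> P"
      then have "a \<in> C \<and> b \<in> N \<or> b \<in> C \<and> a \<in> N" by (auto simp: P_def doubleton_eq_iff)
      then show False using that(3) bX CX by (auto simp: X2_def)
    qed
    ultimately show ?thesis using that(1) bX by (auto simp: E2_def E'_def del_vertex_iff X2_def)
  qed
  have "chain_edges E2" unfolding chain_edges_def
  proof (intro exI[of _ X2] conjI allI impI)
    fix a b c d assume *: "{a, b} \<in> E2" "{c, d} \<in> E2" "a \<in> X2" "c \<in> X2"
    show "{a, d} \<in> E2 \<or> {c, b} \<in> E2"
    proof (cases "(a \<in> C \<or> a = x) \<and> d \<in> N \<or> (c \<in> C \<or> c = x) \<and> b \<in> N")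
      case True
      then show ?thesis using full by blast
    next
      case False
      then have ab: "{a, b} \<in> E'" and cd: "{c, d} \<in> E'"
        using inE'[OF *(1,3)] inE'[OF *(2,4)] side[OF *(1,3)] side[OF *(2,4)] by blast+
      have "x \<noteq> a" "x \<noteq> c" using ab cd by (auto simp: E'_def del_vertex_iff)
      then have "a \<in> X" "c \<in> X" using * by (auto simp: X2_def)
      then show ?thesis using X(2)[OF ab cd] E'E2 by blast
    qed
  qed (use col in blast)
  moreover have "card (F - P) \<le> k" using card_mono[OF finF, of "F - P"] F(2) by auto
  ultimately show "chain_deletion E k"
    unfolding chain_deletion_def E2_def using FE by (intro exI[of _ "F - P"]) auto
next
  show "chain_deletion E k \<Longrightarrow> chain_deletion (del_vertex E x) k"
    using chain_deletion_del_vertex E finite_subset finite_vertex_pairs by metis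
qed

lemma chain_edges_if_conflict_free:
  assumes E: "E \<subseteq> vertex_pairs V" "finite V"
    and free: "\<And>z w x. {z, w} \<in> E \<Longrightarrow> x \<in> V \<Longrightarrow> \<not> conflict E z w x"
  shows "chain_edges E"
proof (cases "V = {}")
  case True
  then have "E = {}" using E(1) by (auto simp: vertex_pairs_def)
  then show ?thesis by (simp add: chain_edges_def)
next
  case False
  have fin: "finite (nbh E v)" for v using nbh_subset[OF E(1)] E(2) finite_subset by metis
  obtain x where x: "x \<in> V" and mx: "\<And>v. v \<in> V \<Longrightarrow> card (nbh E v) \<le> card (nbh E x)"
    using obtains_MAX[OF E(2) False, of "\<lambda>v. card (nbh E v)"] E(2)
    by (metis Max_ge finite_imageI imageI)
  have dom: False if "{u, v} \<in> E" "v \<notin> nbh E x" "nbh E x \<subseteq> nbh E u" for u v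
  proof -
    have "nbh E x \<subset> nbh E u" using that by auto
    then have "card (nbh E x) < card (nbh E u)" using fin psubset_card_mono by blast
    then show False using mx[of u] vertex_pairs_edgeD(1)[OF E(1) that(1)] by simp
  qed
  have col: "u \<notin> nbh E x \<longleftrightarrow> v \<in> nbh E x" if uv: "{u, v} \<in> E" for u v
  proof -
    have nc: "\<not> conflict E u v x" using free[OF uv x] .
    have vu: "{v, u} \<in> E" using uv by (simp add: insert_commute)
    have "nbh E x \<subseteq> nbh E u \<or> nbh E x \<subseteq> nbh E v" if "u \<notin> nbh E x" "v \<notin> nbh E x"
      using nc that unfolding conflict_def nbh_def by (auto simp: insert_commute)
    then show ?thesis using dom[OF uv] dom[OF vu] nc unfolding conflict_def by auto
  qed
  show ?thesis unfolding chain_edges_def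
  proof (intro exI[of _ "- nbh E x"] conjI allI impI)
    fix a b c d assume *: "{a, b} \<in> E" "{c, d} \<in> E" "a \<in> - nbh E x" "c \<in> - nbh E x"
    show "{a, d} \<in> E \<or> {c, b} \<in> E"
    proof (rule ccontr)
      assume n: "\<not> ?thesis"
      have "{c, a} \<notin> E" using col[of c a] *(3,4) by blast
      moreover have "{d, b} \<notin> E" using col[of d b] col[OF *(1)] col[OF *(2)] *(3,4) by blast
      moreover have "{d, a} \<notin> E" "{c, b} \<notin> E" using n by (auto simp: insert_commute)
      ultimately have "conflict E a b c" unfolding conflict_def using *(2) by blast
      then show False using free[OF *(1)] vertex_pairs_edgeD(1)[OF E(1) *(2)] by blast
    qed
  qed (use col in auto)
qed

definition forced_edge :: "'a set set \<Rightarrow> 'a set \<Rightarrow> nat \<Rightarrow> 'a \<Rightarrow> 'a \<Rightarrow> bool" where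
  "forced_edge E V k z w \<longleftrightarrow> {z, w} \<in> E \<and> 2 * k < card {x \<in> V. conflict E z w x}"

definition removable :: "'a set set \<Rightarrow> 'a set \<Rightarrow> nat \<Rightarrow> 'a \<Rightarrow> bool" where
  "removable E V k x \<longleftrightarrow> 2 * k < card (twins E V x) \<or>
     (\<forall>z w. {z, w} \<in> E \<longrightarrow> \<not> conflict E z w x) \<and> 2 * k < card (nbh E x) \<and>
     2 * k < card (dominators E V x)"

lemma chain_deletion_removable:
  assumes "E \<subseteq> vertex_pairs V" "finite V" "removable E V k x"
  shows "chain_deletion E k \<longleftrightarrow> chain_deletion (del_vertex E x) k"
  using assms(3)[unfolded removable_def]
proof (elim disjE conjE)
  assume "2 * k < card (twins E V x)"
  then show ?thesis by (rule chain_deletion_twin[OF assms(1,2)])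
next
  assume *: "\<forall>z w. {z, w} \<in> E \<longrightarrow> \<not> conflict E z w x" "2 * k < card (nbh E x)"
    "2 * k < card (dominators E V x)"
  show ?thesis by (rule chain_deletion_conflict_free[OF assms(1,2) _ *(2,3)]) (use *(1) in blast)
qed

lemma card_nested_twins_le:
  fixes k :: nat
  assumes E: "E \<subseteq> vertex_pairs V" "finite V" and S: "S \<subseteq> V"
    and nest: "\<And>x x'. x \<in> S \<Longrightarrow> x' \<in> S \<Longrightarrow> nbh E x \<subseteq> nbh E x' \<or> nbh E x' \<subseteq> nbh E x"
    and tw: "\<And>x. x \<in> S \<Longrightarrow> card (twins E V x) \<le> k"
    and small: "\<And>x. x \<in> S \<Longrightarrow> card (nbh E x) \<le> k"
  shows "card S \<le> (k + 1) * (k + 1)"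
proof -
  have fin: "finite (nbh E v)" for v using nbh_subset[OF E(1)] E(2) finite_subset by metis
  have level: "card {x \<in> S. card (nbh E x) = j} \<le> k + 1" for j
  proof (cases "\<exists>x \<in> S. card (nbh E x) = j")
    case True
    then obtain x where x: "x \<in> S" "card (nbh E x) = j" by blast
    have "{x \<in> S. card (nbh E x) = j} \<subseteq> insert x (twins E V x)"
    proof
      fix z assume z: "z \<in> {x \<in> S. card (nbh E x) = j}"
      then have "nbh E x = nbh E z"
        using nest[OF x(1), of z] x(2) card_subset_eq[OF fin, of "nbh E x" z]
          card_subset_eq[OF fin, of "nbh E z" x] by auto
      then show "z \<in> insert x (twins E V x)" using z S by (auto simp: twins_def)
    qed
    moreover have ft: "finite (twins E V x)" using E(2) by (simp add: twins_def)
    ultimately have "card {x \<in> S. card (nbh E x) = j} \<le> card (insert x (twins E V x))"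
      by (intro card_mono) auto
    also have "\<dots> \<le> k + 1" using tw[OF x(1)] ft by (simp add: card_insert_if)
    finally show ?thesis .
  next
    case False
    then have "{x \<in> S. card (nbh E x) = j} = {}" by blast
    then show ?thesis by (metis card.empty le0)
  qed
  have "S = (\<Union>j \<in> {..k}. {x \<in> S. card (nbh E x) = j})" using small by auto
  then have "card S = card (\<Union>j \<in> {..k}. {x \<in> S. card (nbh E x) = j})" by (rule arg_cong)
  also have "\<dots> \<le> (\<Sum>j \<in> {..k}. card {x \<in> S. card (nbh E x) = j})"
    by (rule card_UN_le) simp
  also have "\<dots> \<le> (\<Sum>j \<in> {..k}. k + 1)" by (rule sum_mono) (rule level)
  finally show ?thesis by simp
qed

lemma card_nested_dominators_le:
  fixes k :: nat
  assumes E: "E \<subseteq> vertex_pairs V" "finite V" and S: "S \<subseteq> V"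
    and nest: "\<And>x x'. x \<in> S \<Longrightarrow> x' \<in> S \<Longrightarrow> nbh E x \<subseteq> nbh E x' \<or> nbh E x' \<subseteq> nbh E x"
    and dom: "\<And>x. x \<in> S \<Longrightarrow> card (dominators E V x) \<le> k"
  shows "card S \<le> k + 1"
proof (cases "S = {}")
  case False
  have fin: "finite (nbh E v)" for v using nbh_subset[OF E(1)] E(2) finite_subset by metis
  have finS: "finite S" using S E(2) finite_subset by blast
  obtain x where x: "x \<in> S" and mn: "\<And>v. v \<in> S \<Longrightarrow> card (nbh E x) \<le> card (nbh E v)"
    using obtains_MIN[OF finS False, of "\<lambda>v. card (nbh E v)"] finS
    by (metis Min_le finite_imageI imageI)
  have "S \<subseteq> insert x (dominators E V x)"
  proof
    fix z assume z: "z \<in> S"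
    have "nbh E x \<subseteq> nbh E z"
      using nest[OF x z] mn[OF z] card_seteq[OF fin] by blast
    then show "z \<in> insert x (dominators E V x)" using z S by (auto simp: dominators_def)
  qed
  moreover have fd: "finite (dominators E V x)" using E(2) by (simp add: dominators_def)
  ultimately have "card S \<le> card (insert x (dominators E V x))" by (intro card_mono) auto
  also have "\<dots> \<le> k + 1" using dom[OF x] fd by (simp add: card_insert_if)
  finally show ?thesis .
qed simp

lemma reduced_card_le:
  assumes E: "E \<subseteq> vertex_pairs V" "finite V" and del: "chain_deletion E k" and k: "0 < k"
    and nf: "\<And>z w. z \<in> V \<Longrightarrow> w \<in> V \<Longrightarrow> \<not> forced_edge E V k z w"
    and nr: "\<And>x. x \<in> V \<Longrightarrow> \<not> removable E V k x"
  shows "card V \<le> 28 * (k * k)"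
proof -
  obtain F where F: "F \<subseteq> E" "card F \<le> k" "chain_edges (E - F)"
    using del unfolding chain_deletion_def by blast
  have FV: "F \<subseteq> vertex_pairs V" using F(1) E(1) by blast
  have finF: "finite F" using FV E(2) finite_subset finite_vertex_pairs by metis
  define T where "T = \<Union>F"
  have T: "card T \<le> 2 * k" using card_Union_pairs[OF FV E(2)] F(2) unfolding T_def by linarith
  have TV: "T \<subseteq> V" using FV by (auto simp: T_def vertex_pairs_def)
  define B where "B = (\<Union>e \<in> F. {x \<in> V. \<exists>z w. e = {z, w} \<and> conflict E z w x})"
  have sym: "conflict E z w x \<longleftrightarrow> conflict E w z x" for z w x by (auto simp: conflict_def)
  have "card {x \<in> V. \<exists>z w. e = {z, w} \<and> conflict E z w x} \<le> 2 * k" if eF: "e \<in> F" for e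
  proof -
    obtain z w where zw: "e = {z, w}" "z \<in> V" "w \<in> V" 
      by (rule vertex_pairsE[OF subsetD[OF FV eF]])
    have "{x \<in> V. \<exists>z w. e = {z, w} \<and> conflict E z w x} = {x \<in> V. conflict E z w x}"
      using sym by (auto simp: zw(1) doubleton_eq_iff)
    then show ?thesis using nf[OF zw(2,3)] eF F(1) zw(1) by (auto simp: forced_edge_def)
  qed
  then have "card B \<le> (\<Sum>e \<in> F. 2 * k)"
    unfolding B_def by (intro order_trans[OF card_UN_le[OF finF]] sum_mono)
  also have "\<dots> = card F * (2 * k)" by simp
  also have "\<dots> \<le> k * (2 * k)" by (rule mult_le_mono1[OF F(2)])
  finally have B: "card B \<le> 2 * (k * k)" by (simp add: ac_simps)
  obtain X where X: "\<And>u v. {u, v} \<in> E - F \<Longrightarrow> u \<in> X \<longleftrightarrow> v \<notin> X"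
    "\<And>a b c d. {a, b} \<in> E - F \<Longrightarrow> {c, d} \<in> E - F \<Longrightarrow> a \<in> X \<Longrightarrow> c \<in> X \<Longrightarrow>
      {a, d} \<in> E - F \<or> {c, b} \<in> E - F"
    using F(3) unfolding chain_edges_def by blast
  have unt: "{x, y} \<in> E - F \<longleftrightarrow> {x, y} \<in> E" if "x \<notin> T" for x y using that by (auto simp: T_def)
  have nest: "nbh E x \<subseteq> nbh E x' \<or> nbh E x' \<subseteq> nbh E x"
    if "x \<in> V - T" "x' \<in> V - T" "x \<in> X \<longleftrightarrow> x' \<in> X" for x x'
  proof (rule ccontr)
    assume "\<not> ?thesis"
    then obtain y y' where y: "{x, y} \<in> E" "{x', y} \<notin> E" "{x', y'} \<in> E" "{x, y'} \<notin> E"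
      unfolding nbh_def by blast
    have e: "{x, y} \<in> E - F" "{x', y'} \<in> E - F" using unt y that by blast+
    then have e': "{y, x} \<in> E - F" "{y', x'} \<in> E - F" by (simp_all add: insert_commute)
    have n: "{y, x'} \<notin> E" "{y', x} \<notin> E" using y by (simp_all add: insert_commute)
    show False using X(2)[OF e] X(2)[OF e'] X(1)[OF e(1)] X(1)[OF e(2)] y n that(3) by blast
  qed
  define S1 where "S1 Q = {x \<in> V - T. (x \<in> X \<longleftrightarrow> Q) \<and> card (nbh E x) \<le> 2 * k}" for Q
  define S2 where "S2 Q = {x \<in> V - T. (x \<in> X \<longleftrightarrow> Q) \<and> card (dominators E V x) \<le> 2 * k}" for Q
  have tw: "card (twins E V x) \<le> 2 * k" if "x \<in> V" for x
    using nr[OF that] by (auto simp: removable_def)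
  have S1: "card (S1 Q) \<le> (2 * k + 1) * (2 * k + 1)" for Q
  proof (rule card_nested_twins_le[OF E])
    fix x x' assume "x \<in> S1 Q" "x' \<in> S1 Q"
    then show "nbh E x \<subseteq> nbh E x' \<or> nbh E x' \<subseteq> nbh E x" by (intro nest) (auto simp: S1_def)
  qed (auto simp: S1_def intro: tw)
  have S2: "card (S2 Q) \<le> 2 * k + 1" for Q
  proof (rule card_nested_dominators_le[OF E])
    fix x x' assume "x \<in> S2 Q" "x' \<in> S2 Q"
    then show "nbh E x \<subseteq> nbh E x' \<or> nbh E x' \<subseteq> nbh E x" by (intro nest) (auto simp: S2_def)
  qed (auto simp: S2_def)
  have "V \<subseteq> T \<union> B \<union> (S1 True \<union> S1 False) \<union> (S2 True \<union> S2 False)"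
  proof
    fix x assume x: "x \<in> V"
    show "x \<in> T \<union> B \<union> (S1 True \<union> S1 False) \<union> (S2 True \<union> S2 False)"
    proof (cases "x \<in> T")
      case False
      consider z w where "{z, w} \<in> E" "conflict E z w x"
        | "card (nbh E x) \<le> 2 * k" | "card (dominators E V x) \<le> 2 * k"
        using nr[OF x] unfolding removable_def by (meson not_less)
      then show ?thesis
      proof cases
        case 1
        then have "{z, w} \<in> F" using conflict_deletion[OF F(3)] False T_def by blast
        then show ?thesis using 1 x by (auto simp: B_def)
      qed (use x False in \<open>auto simp: S1_def S2_def\<close>)
    qed simp
  qed
  moreover have "finite (T \<union> B \<union> (S1 True \<union> S1 False) \<union> (S2 True \<union> S2 False))"
    by (rule finite_subset[OF _ E(2)]) (use TV in \<open>auto simp: B_def S1_def S2_def\<close>)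
  ultimately have "card V \<le> card (T \<union> B \<union> (S1 True \<union> S1 False) \<union> (S2 True \<union> S2 False))"
    by (rule card_mono[rotated])
  also have "\<dots> \<le> card T + card B + (card (S1 True) + card (S1 False)) + (card (S2 True) + card (S2 False))"
    by (meson add_mono card_Un_le order_trans order_refl)
  also have "\<dots> \<le> 2 * k + 2 * (k * k) + ((2 * k + 1) * (2 * k + 1) + (2 * k + 1) * (2 * k + 1))
      + ((2 * k + 1) + (2 * k + 1))"
    by (intro add_mono T B S1 S2)
  also have "\<dots> = 10 * (k * k) + 14 * k + 4" by (simp add: algebra_simps)
  also have "\<dots> \<le> 28 * (k * k)"
  proof -
    have "k \<le> k * k" "1 \<le> k * k" using k by (simp_all add: Suc_le_eq)
    then show ?thesis by linarith
  qed
  finally show ?thesis .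
qed

lemma nested_list_exists:
  assumes "finite X" "\<And>x. x \<in> X \<Longrightarrow> finite (f x)"
    "\<And>x x'. x \<in> X \<Longrightarrow> x' \<in> X \<Longrightarrow> f x \<subseteq> f x' \<or> f x' \<subseteq> f x"
  obtains xs where "distinct xs" "set xs = X" "\<And>i. Suc i < length xs \<Longrightarrow> f (xs ! i) \<subseteq> f (xs ! Suc i)"
proof -
  obtain ys where ys: "set ys = X" "distinct ys" using finite_distinct_list[OF assms(1)] by blast
  let ?xs = "sort_key (\<lambda>x. card (f x)) ys"
  show ?thesis
  proof (rule that[of ?xs])
    fix i assume i: "Suc i < length ?xs"
    have m: "?xs ! i \<in> X" "?xs ! Suc i \<in> X"
      using i ys(1) by (metis Suc_lessD nth_mem set_sort)+
    have "sorted (map (\<lambda>x. card (f x)) ?xs)" by simp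
    then have "card (f (?xs ! i)) \<le> card (f (?xs ! Suc i))"
      using i by (auto simp: sorted_iff_nth_Suc)
    then show "f (?xs ! i) \<subseteq> f (?xs ! Suc i)"
      using assms(3)[OF m] card_seteq[OF assms(2)[OF m(1)]] by blast
  qed (use ys in auto)
qed

lemma biclique_chain_graph_iff:
  assumes fin: "finite V" and D: "D \<subseteq> vertex_pairs V"
  shows "biclique_chain_graph (V, D) \<longleftrightarrow> chain_edges (vertex_pairs V - D)"
proof
  assume "biclique_chain_graph (V, D)"
  then obtain X Y xs where c: "vertex_pairs X \<subseteq> D" "vertex_pairs Y \<subseteq> D"
    and j: "X \<union> Y = V" "X \<inter> Y = {}" "set xs = X"
      "\<And>i. Suc i < length xs \<Longrightarrow> nbrs_in (V, D) Y (xs ! i) \<subseteq> nbrs_in (V, D) Y (xs ! Suc i)"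
    unfolding biclique_chain_graph_def is_clique_def is_join_def by auto
  have mono: "nbrs_in (V, D) Y (xs ! i) \<subseteq> nbrs_in (V, D) Y (xs ! i')"
    if "i \<le> i'" "i' < length xs" for i i'
    using that
  proof (induction i' rule: dec_induct)
    case (step m)
    then show ?case using j(4)[of m] by auto
  qed simp
  have cl: "{u, v} \<notin> vertex_pairs V - D" if "u \<in> X \<and> v \<in> X \<or> u \<in> Y \<and> v \<in> Y" for u v
  proof
    assume uv: "{u, v} \<in> vertex_pairs V - D"
    then have "u \<noteq> v" by simp
    then have "{u, v} \<in> vertex_pairs X \<union> vertex_pairs Y" using that by auto
    then show False using uv c by blast
  qed
  show "chain_edges (vertex_pairs V - D)" unfolding chain_edges_def
  proof (intro exI[of _ X] conjI allI impI)
    fix u v assume uv: "{u, v} \<in> vertex_pairs V - D"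
    then have "u \<in> V" "v \<in> V" by auto
    then show "u \<in> X \<longleftrightarrow> v \<notin> X" using cl[of u v] uv j(1,2) by blast
  next
    fix a b c d
    assume *: "{a, b} \<in> vertex_pairs V - D" "{c, d} \<in> vertex_pairs V - D" "a \<in> X" "c \<in> X"
    have "b \<in> Y" "d \<in> Y" using cl[of a b] cl[of c d] * j(1,2) by auto
    obtain p q where pq: "p < length xs" "xs ! p = a" "q < length xs" "xs ! q = c"
      using *(3,4) j(3) by (metis in_set_conv_nth)
    have "nbrs_in (V, D) Y a \<subseteq> nbrs_in (V, D) Y c \<or> nbrs_in (V, D) Y c \<subseteq> nbrs_in (V, D) Y a"
      using mono pq by (metis nat_le_linear)
    then have "{a, d} \<notin> D \<or> {c, b} \<notin> D"
      using * \<open>b \<in> Y\<close> \<open>d \<in> Y\<close> by (auto simp: nbrs_in_def)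
    then show "{a, d} \<in> vertex_pairs V - D \<or> {c, b} \<in> vertex_pairs V - D"
      using * \<open>b \<in> Y\<close> \<open>d \<in> Y\<close> j(1,2) by auto
  qed
next
  assume "chain_edges (vertex_pairs V - D)"
  then obtain X where X: "\<And>u v. {u, v} \<in> vertex_pairs V - D \<Longrightarrow> u \<in> X \<longleftrightarrow> v \<notin> X"
    "\<And>a b c d. {a, b} \<in> vertex_pairs V - D \<Longrightarrow> {c, d} \<in> vertex_pairs V - D \<Longrightarrow> a \<in> X \<Longrightarrow> c \<in> X \<Longrightarrow>
      {a, d} \<in> vertex_pairs V - D \<or> {c, b} \<in> vertex_pairs V - D"
    unfolding chain_edges_def by blast
  have cl: "is_clique (V, D) (V \<inter> X)" "is_clique (V, D) (V - X)"
    unfolding is_clique_def using X(1) by (auto elim!: vertex_pairsE)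
  have nest: "nbrs_in (V, D) (V - X) x \<subseteq> nbrs_in (V, D) (V - X) x' \<or>
    nbrs_in (V, D) (V - X) x' \<subseteq> nbrs_in (V, D) (V - X) x"
    if x: "x \<in> V \<inter> X" "x' \<in> V \<inter> X" for x x'
  proof (rule ccontr)
    assume "\<not> ?thesis"
    then obtain y y' where y: "y \<in> V - X" "{x, y} \<in> D" "{x', y} \<notin> D"
      "y' \<in> V - X" "{x', y'} \<in> D" "{x, y'} \<notin> D"
      by (auto simp: nbrs_in_def)
    then have "{x, y'} \<in> vertex_pairs V - D" "{x', y} \<in> vertex_pairs V - D" using x by auto
    then show False using X(2) x y by blast
  qed
  have "finite (V \<inter> X)" using fin by simp
  moreover have "finite (nbrs_in (V, D) (V - X) x)" for x using fin by (simp add: nbrs_in_def)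
  ultimately obtain xs where "distinct xs" "set xs = V \<inter> X"
    "\<And>i. Suc i < length xs \<Longrightarrow>
      nbrs_in (V, D) (V - X) (xs ! i) \<subseteq> nbrs_in (V, D) (V - X) (xs ! Suc i)"
    using nested_list_exists[of "V \<inter> X" "nbrs_in (V, D) (V - X)"] nest by metis
  then have "is_join (V, D) (V \<inter> X) (V - X) xs" unfolding is_join_def by auto
  then show "biclique_chain_graph (V, D)"
    unfolding biclique_chain_graph_def simple_graph_def using fin D cl by auto
qed

lemma biclique_chain_completion_iff:
  assumes "simple_graph G"
  shows "biclique_chain_completion G k \<longleftrightarrow> chain_deletion (vertex_pairs (verts G) - edges G) k"
proof -
  have fin: "finite (verts G)" and D: "edges G \<subseteq> vertex_pairs (verts G)"
    using assms by (auto simp: simple_graph_def)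
  have "biclique_chain_graph (verts G, edges G \<union> F) \<longleftrightarrow>
      chain_edges (vertex_pairs (verts G) - edges G - F)"
    if "F \<subseteq> vertex_pairs (verts G) - edges G" for F
  proof -
    have "edges G \<union> F \<subseteq> vertex_pairs (verts G)" using that D by blast
    moreover have "vertex_pairs (verts G) - (edges G \<union> F) = vertex_pairs (verts G) - edges G - F" by blast
    ultimately show ?thesis using biclique_chain_graph_iff[OF fin] by metis
  qed
  then show ?thesis unfolding biclique_chain_completion_def chain_deletion_def by blast
qed

lemma not_chain_deletion_K4:
  "\<not> chain_deletion (vertex_pairs {0, 1, 2, 3 :: nat}) 1"
proof
  let ?E = "vertex_pairs {0, 1, 2, 3 :: nat}"
  assume "chain_deletion ?E 1"
  then obtain F where F: "F \<subseteq> ?E" "card F \<le> 1" "chain_edges (?E - F)"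
    unfolding chain_deletion_def by blast
  obtain X where X: "\<And>u v. {u, v} \<in> ?E - F \<Longrightarrow> u \<in> X \<longleftrightarrow> v \<notin> X"
    using F(3) unfolding chain_edges_def by blast
  have "finite F" using F(1) by (rule finite_subset) simp
  then obtain e where "F \<subseteq> {e}" using F(2) card_le_Suc0_iff_eq[of F] by (cases "F = {}") auto
  then have *: "{u, v} = e \<or> (u \<in> X \<longleftrightarrow> v \<notin> X)" if "{u, v} \<in> ?E" for u v using X that by blast
  have tri: "{a, b} = e \<or> {a, c} = e \<or> {b, c} = e" if "{a, b} \<in> ?E" "{a, c} \<in> ?E" "{b, c} \<in> ?E" for a b c
    using *[OF that(1)] *[OF that(2)] *[OF that(3)] by blast
  have "3 \<notin> e" using tri[of 0 1 2] by auto
  moreover have "2 \<notin> e" using tri[of 0 1 3] by auto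
  moreover have "1 \<notin> e" using tri[of 0 2 3] by auto
  ultimately show False using tri[of 1 2 3] by auto
qed

section \<open>Timed execution and counting formulas\<close>

definition runs :: "com \<Rightarrow> state \<Rightarrow> nat \<Rightarrow> (state \<Rightarrow> bool) \<Rightarrow> bool" where
  "runs p s T Q \<longleftrightarrow> (\<exists>t s'. exec p s t s' \<and> t \<le> T \<and> Q s')"

lemma runs_weaken:
  "runs p s T Q \<Longrightarrow> T \<le> T' \<Longrightarrow> (\<And>s'. Q s' \<Longrightarrow> Q' s') \<Longrightarrow> runs p s T' Q'"
  unfolding runs_def by (meson le_trans)

inductive_cases exec_AssignE: "exec (Assign x i a) s t s'"
inductive_cases exec_SeqE: "exec (Seq p q) s t s'"
inductive_cases exec_CondE: "exec (Cond b p q) s t s'"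

lemma runs_Assign [simp]:
  "runs (Assign x i a) s T Q \<longleftrightarrow> 1 \<le> T \<and> Q (s(x := (s x)(aval i s := aval a s)))"
proof
  assume "runs (Assign x i a) s T Q"
  then show "1 \<le> T \<and> Q (s(x := (s x)(aval i s := aval a s)))"
    unfolding runs_def by (auto elim!: exec_AssignE)
next
  assume "1 \<le> T \<and> Q (s(x := (s x)(aval i s := aval a s)))"
  then show "runs (Assign x i a) s T Q" unfolding runs_def using exec.Assign by blast
qed

lemma runs_Seq:
  assumes "runs p s T1 (\<lambda>s'. runs q s' T2 Q)"
  shows "runs (Seq p q) s (T1 + T2) Q"
proof -
  obtain t s' where p: "exec p s t s'" "t \<le> T1" "runs q s' T2 Q" using assms unfolding runs_def by blast
  then obtain u s'' where q: "exec q s' u s''" "u \<le> T2" "Q s''" unfolding runs_def by blast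
  show ?thesis unfolding runs_def using exec.Seq[OF p(1) q(1)] p(2) q(2,3) by (meson add_mono)
qed

lemma runs_Seq_Assign [simp]:
  "runs (Seq (Assign x i a) q) s T Q \<longleftrightarrow> 1 \<le> T \<and> runs q (s(x := (s x)(aval i s := aval a s))) (T - 1) Q"
proof
  assume "runs (Seq (Assign x i a) q) s T Q"
  then obtain t s' where *: "exec (Seq (Assign x i a) q) s t s'" "t \<le> T" "Q s'" unfolding runs_def by blast
  from *(1) obtain u where "exec q (s(x := (s x)(aval i s := aval a s))) u s'" "t = 1 + u"
    by (auto elim!: exec_SeqE exec_AssignE)
  then show "1 \<le> T \<and> runs q (s(x := (s x)(aval i s := aval a s))) (T - 1) Q"
    using *(2,3) unfolding runs_def by (auto intro!: exI[of _ u] exI[of _ s'])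
next
  assume "1 \<le> T \<and> runs q (s(x := (s x)(aval i s := aval a s))) (T - 1) Q"
  then show "runs (Seq (Assign x i a) q) s T Q"
    using runs_Seq[of "Assign x i a" s 1 q "T - 1" Q] by simp
qed

lemma runs_Cond [simp]:
  "runs (Cond b p q) s T Q \<longleftrightarrow> 1 \<le> T \<and> (if bval b s then runs p s (T - 1) Q else runs q s (T - 1) Q)"
proof
  assume "runs (Cond b p q) s T Q"
  then obtain t s' where *: "exec (Cond b p q) s t s'" "t \<le> T" "Q s'" unfolding runs_def by blast
  from *(1) obtain u where "exec (if bval b s then p else q) s u s'" "t = u + 1"
    by (auto elim!: exec_CondE)
  then show "1 \<le> T \<and> (if bval b s then runs p s (T - 1) Q else runs q s (T - 1) Q)"
    using *(2,3) unfolding runs_def by (auto intro!: exI[of _ u] exI[of _ s'] split: if_splits)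
next
  assume *: "1 \<le> T \<and> (if bval b s then runs p s (T - 1) Q else runs q s (T - 1) Q)"
  then obtain u s' where u: "exec (if bval b s then p else q) s u s'" "u \<le> T - 1" "Q s'"
    unfolding runs_def by (auto split: if_splits)
  have "exec (Cond b p q) s (u + 1) s'"
    using u(1) exec.CondTrue[of b s p u s' q] exec.CondFalse[of b s q u s' p] by (cases "bval b s") auto
  then show "runs (Cond b p q) s T Q" unfolding runs_def using u(2,3) * by (intro exI[of _ "u + 1"] exI[of _ s']) auto
qed

lemma runs_While:
  fixes \<mu> :: "state \<Rightarrow> nat"
  assumes step: "\<And>s. I s \<Longrightarrow> bval b s \<Longrightarrow> runs p s T (\<lambda>s'. I s' \<and> \<mu> s' < \<mu> s)"
    and "I s" "\<mu> s \<le> M"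
  shows "runs (While b p) s (M * (T + 1) + 1) (\<lambda>s'. I s' \<and> \<not> bval b s')"
  using assms(2,3)
proof (induction M arbitrary: s)
  case 0
  then have "\<not> bval b s" using step[of s] by (auto simp: runs_def)
  then show ?case unfolding runs_def using exec.WhileFalse 0 by fastforce
next
  case (Suc M)
  show ?case
  proof (cases "bval b s")
    case True
    obtain t s' where p: "exec p s t s'" "t \<le> T" "I s'" "\<mu> s' < \<mu> s"
      using step[OF Suc.prems(1) True] unfolding runs_def by blast
    then have "\<mu> s' \<le> M" using Suc.prems(2) by linarith
    then obtain u s'' where q: "exec (While b p) s' u s''" "u \<le> M * (T + 1) + 1" "I s''" "\<not> bval b s''"
      using Suc.IH[OF p(3)] unfolding runs_def by blast
    show ?thesis unfolding runs_def
      using exec.WhileTrue[OF True p(1) q(1)] p(2) q(2-4) by (intro exI[of _ "t + u + 1"] exI[of _ s'']) auto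
  next
    case False
    then show ?thesis unfolding runs_def using exec.WhileFalse Suc.prems by fastforce
  qed
qed

lemma runs_for:
  assumes step: "\<And>i s. i < N \<Longrightarrow> I i s \<Longrightarrow> runs p s T (I (Suc i))"
    and guard: "\<And>i s. i \<le> N \<Longrightarrow> I i s \<Longrightarrow> bval b s \<longleftrightarrow> i < N"
    and "I 0 s"
  shows "runs (While b p) s (N * (T + 1) + 1) (I N)"
proof -
  have "runs (While b p) s (d * (T + 1) + 1) (I N)" if "i + d = N" "I i s" for i d s
    using that
  proof (induction d arbitrary: i s)
    case 0
    then have "exec (While b p) s 1 s" using guard[of i s] by (intro exec.WhileFalse) auto
    then show ?case unfolding runs_def using 0 by auto
  next
    case (Suc d)
    then have i: "i < N" and b: "bval b s" using guard[of i s] by auto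
    obtain t s' where p: "exec p s t s'" "t \<le> T" "I (Suc i) s'"
      using step[OF i Suc.prems(2)] unfolding runs_def by blast
    then obtain u s'' where q: "exec (While b p) s' u s''" "u \<le> d * (T + 1) + 1" "I N s''"
      using Suc.IH[of "Suc i" s'] Suc.prems(1) unfolding runs_def by auto
    show ?case unfolding runs_def
      using exec.WhileTrue[OF b p(1) q(1)] p(2) q(2,3)
      by (intro exI[of _ "t + u + 1"] exI[of _ s'']) auto
  qed
  then show ?thesis using assms(3) by simp
qed

primrec avars :: "aexp \<Rightarrow> vname set" where
  "avars (Const n) = {}"
| "avars (Cell x a) = insert x (avars a)"
| "avars (Add a b) = avars a \<union> avars b"
| "avars (Sub a b) = avars a \<union> avars b"

primrec bvars :: "bexp \<Rightarrow> vname set" where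
  "bvars (Less a b) = avars a \<union> avars b"
| "bvars (Neg b) = bvars b"
| "bvars (Conj b c) = bvars b \<union> bvars c"

lemma aval_cong: "(\<And>x. x \<in> avars a \<Longrightarrow> s x = s' x) \<Longrightarrow> aval a s = aval a s'"
  by (induction a) auto

lemma bval_cong: "(\<And>x. x \<in> bvars b \<Longrightarrow> s x = s' x) \<Longrightarrow> bval b s = bval b s'"
  by (induction b) (auto simp: aval_cong[of _ s s'])

abbreviation Var :: "vname \<Rightarrow> aexp" where "Var x \<equiv> Cell x (Const 0)"

definition upd :: "state \<Rightarrow> vname \<Rightarrow> nat \<Rightarrow> state" where
  "upd s x i = s(x := (s x)(0 := i))"

datatype fm = Atom bexp | NotF fm | AndF fm fm | MoreF vname aexp fm

primrec fval :: "fm \<Rightarrow> state \<Rightarrow> bool" where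
  "fval (Atom b) s \<longleftrightarrow> bval b s"
| "fval (NotF f) s \<longleftrightarrow> \<not> fval f s"
| "fval (AndF f g) s \<longleftrightarrow> fval f s \<and> fval g s"
| "fval (MoreF v a f) s \<longleftrightarrow> aval a s < card {i. i < s ''m'' 0 \<and> fval f (upd s v i)}"

primrec free_vars :: "fm \<Rightarrow> vname set" where
  "free_vars (Atom b) = bvars b"
| "free_vars (NotF f) = free_vars f"
| "free_vars (AndF f g) = free_vars f \<union> free_vars g"
| "free_vars (MoreF v a f) = avars a \<union> {''m''} \<union> (free_vars f - {v})"

primrec bound_vars :: "fm \<Rightarrow> vname set" where
  "bound_vars (Atom b) = {}"
| "bound_vars (NotF f) = bound_vars f"
| "bound_vars (AndF f g) = bound_vars f \<union> bound_vars g"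
| "bound_vars (MoreF v a f) = insert v (bound_vars f)"

primrec compilable :: "fm \<Rightarrow> bool" where
  "compilable (Atom b) \<longleftrightarrow> True"
| "compilable (NotF f) \<longleftrightarrow> compilable f"
| "compilable (AndF f g) \<longleftrightarrow> compilable f \<and> compilable g \<and> free_vars g \<inter> bound_vars f = {}"
| "compilable (MoreF v a f) \<longleftrightarrow> compilable f \<and> v \<notin> {''r'', ''c'', ''m''} \<and> v \<notin> bound_vars f \<and>
     ''m'' \<notin> bound_vars f \<and> avars a \<inter> insert v (bound_vars f) = {} \<and> free_vars f \<inter> bound_vars f = {}"

primrec scratch_free :: "fm \<Rightarrow> bool" where
  "scratch_free (Atom b) \<longleftrightarrow> bvars b \<inter> {''r'', ''c''} = {}"
| "scratch_free (NotF f) \<longleftrightarrow> scratch_free f"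
| "scratch_free (AndF f g) \<longleftrightarrow> scratch_free f \<and> scratch_free g"
| "scratch_free (MoreF v a f) \<longleftrightarrow> scratch_free f \<and> avars a \<inter> {''r'', ''c''} = {}"

definition same_except :: "vname set \<Rightarrow> state \<Rightarrow> state \<Rightarrow> bool" where
  "same_except B s s' \<longleftrightarrow> (\<forall>x i. x \<notin> {''r'', ''c''} \<longrightarrow> x \<notin> B \<or> 0 < i \<longrightarrow> s' x i = s x i)"

lemma same_exceptD: "same_except B s s' \<Longrightarrow> x \<notin> B \<Longrightarrow> x \<notin> {''r'', ''c''} \<Longrightarrow> s' x = s x"
  by (rule ext) (auto simp: same_except_def)

lemma same_except_trans: "same_except B s s' \<Longrightarrow> same_except B' s' s'' \<Longrightarrow> same_except (B \<union> B') s s''"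
  unfolding same_except_def by (metis UnCI)

lemma same_except_mono: "same_except B s s' \<Longrightarrow> B \<subseteq> B' \<Longrightarrow> same_except B' s s'"
  unfolding same_except_def by blast

lemma fval_cong:
  assumes "same_except B s s'" "scratch_free f" "free_vars f \<inter> B = {}"
  shows "fval f s' \<longleftrightarrow> fval f s"
  using assms
proof (induction f arbitrary: s s' B)
  case (Atom b)
  then have "s' x = s x" if "x \<in> bvars b" for x using that by (intro same_exceptD[OF Atom(1)]) auto
  then show ?case using bval_cong[of b s' s] by simp
next
  case (MoreF v a f)
  have x: "s' x = s x" if "x \<in> insert ''m'' (avars a)" for x
    using that MoreF.prems by (intro same_exceptD[OF MoreF.prems(1)]) auto
  have "fval f (upd s' v i) \<longleftrightarrow> fval f (upd s v i)" for i
    by (rule MoreF.IH[of "B - {v}"]) (use MoreF.prems in \<open>auto simp: same_except_def upd_def\<close>)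
  then show ?case using x aval_cong[of a s' s] by simp
next
  case (NotF f)
  then show ?case using NotF.IH[OF NotF.prems(1)] by simp
next
  case (AndF f g)
  then show ?case using AndF.IH(1)[OF AndF.prems(1)] AndF.IH(2)[OF AndF.prems(1)]
    by (auto simp: Int_Un_distrib2)
qed

text \<open>
  Results and counters live in the scratch arrays \<open>r\<close> and \<open>c\<close>, indexed by the nesting depth \<open>d\<close>;
  quantifiers range over the numbers below the cell \<open>m\<close>.
\<close>

primrec compile :: "fm \<Rightarrow> nat \<Rightarrow> com" where
  "compile (Atom b) d = Cond b (Assign ''r'' (Const d) (Const 1)) (Assign ''r'' (Const d) (Const 0))"
| "compile (NotF f) d = Seq (compile f d) (Assign ''r'' (Const d) (Sub (Const 1) (Cell ''r'' (Const d))))"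
| "compile (AndF f g) d = Seq (compile f d) (Seq (compile g (Suc d)) (Assign ''r'' (Const d)
     (Sub (Add (Cell ''r'' (Const d)) (Cell ''r'' (Const (Suc d)))) (Const 1))))"
| "compile (MoreF v a f) d = Seq (Assign ''c'' (Const d) (Const 0)) (Seq (Assign v (Const 0) (Const 0))
     (Seq (While (Less (Var v) (Var ''m''))
        (Seq (compile f (Suc d)) (Seq
          (Assign ''c'' (Const d) (Add (Cell ''c'' (Const d)) (Cell ''r'' (Const (Suc d)))))
          (Assign v (Const 0) (Add (Var v) (Const 1))))))
      (Cond (Less a (Cell ''c'' (Const d))) (Assign ''r'' (Const d) (Const 1)) (Assign ''r'' (Const d) (Const 0)))))"

primrec ctime :: "fm \<Rightarrow> nat \<Rightarrow> nat" where
  "ctime (Atom b) n = 2"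
| "ctime (NotF f) n = ctime f n + 1"
| "ctime (AndF f g) n = ctime f n + (ctime g n + 1)"
| "ctime (MoreF v a f) n = 2 + ((n * (ctime f n + 2 + 1) + 1) + 2)"

definition computed :: "nat \<Rightarrow> fm \<Rightarrow> state \<Rightarrow> state \<Rightarrow> bool" where
  "computed d f s s' \<longleftrightarrow> same_except (bound_vars f) s s' \<and> s' ''r'' d = (if fval f s then 1 else 0) \<and>
     (\<forall>i < d. s' ''r'' i = s ''r'' i \<and> s' ''c'' i = s ''c'' i)"

lemma card_less_Suc_filter:
  "card {i. i < Suc j \<and> P i} = card {i. i < j \<and> P i} + (if P j then 1 else 0 :: nat)"
proof -
  have "{i. i < Suc j \<and> P i} = (if P j then insert j {i. i < j \<and> P i} else {i. i < j \<and> P i})"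
    by (auto simp: less_Suc_eq)
  then show ?thesis by simp
qed

lemma runs_compile:
  assumes "compilable f" "scratch_free f" "''m'' \<notin> bound_vars f" "s ''m'' 0 \<le> n"
  shows "runs (compile f d) s (ctime f n) (computed d f s)"
  using assms
proof (induction f arbitrary: d s)
  case (Atom b)
  then show ?case by (auto simp: computed_def same_except_def)
next
  case (NotF f)
  have "runs (compile f d) s (ctime f n) (computed d f s)" using NotF by simp
  then have "runs (compile (NotF f) d) s (ctime f n + 1) (computed d (NotF f) s)"
    unfolding compile.simps
    by (intro runs_Seq, elim runs_weaken) (auto simp: computed_def same_except_def)
  then show ?case by simp
next
  case (AndF f g)
  have f: "runs (compile f d) s (ctime f n) (computed d f s)" using AndF by simp
  have "runs (compile (AndF f g) d) s (ctime f n + (ctime g n + 1)) (computed d (AndF f g) s)"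
    unfolding compile.simps
  proof (intro runs_Seq runs_weaken[OF f order_refl])
    fix s1 assume s1: "computed d f s s1"
    have "fval g s1 \<longleftrightarrow> fval g s"
      using s1 AndF.prems by (intro fval_cong[of "bound_vars f"]) (auto simp: computed_def)
    moreover have "s1 ''m'' 0 \<le> n"
      using same_exceptD[of "bound_vars f" s s1 "''m''"] s1 AndF.prems by (auto simp: computed_def)
    then have g: "runs (compile g (Suc d)) s1 (ctime g n) (computed (Suc d) g s1)" using AndF by simp
    ultimately show "runs (compile g (Suc d)) s1 (ctime g n) (\<lambda>s2. runs (Assign ''r'' (Const d)
     (Sub (Add (Cell ''r'' (Const d)) (Cell ''r'' (Const (Suc d)))) (Const 1))) s2 1 (computed d (AndF f g) s))"
      using s1 by (elim runs_weaken[OF _ order_refl]) (auto simp: computed_def same_except_def)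
  qed
  then show ?case by simp
next
  case (MoreF v a f)
  define N where "N = s ''m'' 0"
  define B where "B = insert v (bound_vars f)"
  define I where "I j s' \<longleftrightarrow> same_except B s s' \<and> s' v 0 = j \<and>
    s' ''c'' d = card {i. i < j \<and> fval f (upd s v i)} \<and>
    (\<forall>i < d. s' ''r'' i = s ''r'' i \<and> s' ''c'' i = s ''c'' i)" for j s'
  have v: "v \<noteq> ''r''" "v \<noteq> ''c''" "v \<noteq> ''m''" "v \<notin> bound_vars f" using MoreF.prems by auto
  have m: "s' ''m'' 0 = N" if "same_except B s s'" for s'
    using same_exceptD[OF that, of "''m''"] v MoreF.prems by (auto simp: N_def B_def)
  let ?s0 = "upd (s(''c'' := (s ''c'')(d := 0))) v 0"
  let ?body = "Seq (compile f (Suc d)) (Seq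
          (Assign ''c'' (Const d) (Add (Cell ''c'' (Const d)) (Cell ''r'' (Const (Suc d)))))
          (Assign v (Const 0) (Add (Var v) (Const 1))))"
  have loop: "runs (While (Less (Var v) (Var ''m'')) ?body) ?s0 (N * (ctime f n + 2 + 1) + 1) (I N)"
  proof (rule runs_for)
    show "I 0 ?s0" using v by (auto simp: I_def B_def same_except_def upd_def)
  next
    fix j s' assume "j \<le> N" "I j s'"
    then show "bval (Less (Var v) (Var ''m'')) s' \<longleftrightarrow> j < N" using m by (auto simp: I_def)
  next
    fix j s1 assume j: "j < N" and I: "I j s1"
    have f: "runs (compile f (Suc d)) s1 (ctime f n) (computed (Suc d) f s1)"
      using MoreF.IH[of s1 "Suc d"] m[of s1] I MoreF.prems by (auto simp: I_def N_def)
    have "same_except (bound_vars f) (upd s v j) s1"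
      using I v by (auto simp: I_def same_except_def upd_def B_def)
    then have fv: "fval f s1 \<longleftrightarrow> fval f (upd s v j)"
      using MoreF.prems by (intro fval_cong[of "bound_vars f"]) auto
    show "runs ?body s1 (ctime f n + 2) (I (Suc j))"
    proof (intro runs_Seq runs_weaken[OF f order_refl])
      fix s2 assume s2: "computed (Suc d) f s1 s2"
      have "same_except (B \<union> bound_vars f) s s2"
        using same_except_trans[of B s s1 "bound_vars f" s2] I s2 by (auto simp: I_def computed_def)
      moreover have "B \<union> bound_vars f = B" by (auto simp: B_def)
      ultimately have "same_except B s s2" by simp
      moreover have "s2 v 0 = j"
        using same_exceptD[of "bound_vars f" s1 s2 v] s2 v I by (auto simp: computed_def I_def)
      moreover have "s2 ''c'' d = card {i. i < j \<and> fval f (upd s v i)}"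
        "\<forall>i < d. s2 ''r'' i = s ''r'' i \<and> s2 ''c'' i = s ''c'' i"
        "s2 ''r'' (Suc d) = (if fval f (upd s v j) then 1 else 0)"
        using s2 I fv by (auto simp: computed_def I_def)
      ultimately show "runs (Seq
          (Assign ''c'' (Const d) (Add (Cell ''c'' (Const d)) (Cell ''r'' (Const (Suc d)))))
          (Assign v (Const 0) (Add (Var v) (Const 1)))) s2 2 (I (Suc j))"
        using v by (auto simp: I_def card_less_Suc_filter same_except_def B_def)
    qed
  qed
  have "runs (Seq (While (Less (Var v) (Var ''m'')) ?body)
      (Cond (Less a (Cell ''c'' (Const d))) (Assign ''r'' (Const d) (Const 1)) (Assign ''r'' (Const d) (Const 0))))
      ?s0 ((N * (ctime f n + 2 + 1) + 1) + 2) (computed d (MoreF v a f) s)"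
  proof (intro runs_Seq runs_weaken[OF loop order_refl])
    fix s1 assume I: "I N s1"
    have "s1 x = s x" if "x \<in> avars a" for x
      using that I MoreF.prems by (intro same_exceptD[of B]) (auto simp: I_def B_def)
    then have "aval a s1 = aval a s" by (rule aval_cong)
    then show "runs (Cond (Less a (Cell ''c'' (Const d))) (Assign ''r'' (Const d) (Const 1)) (Assign ''r'' (Const d) (Const 0)))
      s1 2 (computed d (MoreF v a f) s)"
      using I by (auto simp: I_def computed_def N_def same_except_def B_def)
  qed
  then have "runs (compile (MoreF v a f) d) s (2 + ((N * (ctime f n + 2 + 1) + 1) + 2)) (computed d (MoreF v a f) s)"
    by (simp add: upd_def)
  then show ?case
    using MoreF.prems(4) by (elim runs_weaken) (simp_all add: N_def del: add_2_eq_Suc add_2_eq_Suc')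
qed

definition search :: "vname \<Rightarrow> fm \<Rightarrow> com" where
  "search v f = Seq (Assign v (Const 0) (Const 0)) (Seq (compile f 0)
     (While (Less (Var ''r'') (Const 1)) (Seq (Assign v (Const 0) (Add (Var v) (Const 1))) (compile f 0))))"

lemma runs_search:
  assumes f: "compilable f" "scratch_free f" "free_vars f \<inter> bound_vars f = {}"
    and v: "v \<notin> bound_vars f" "v \<notin> {''r'', ''c'', ''m''}" and m: "''m'' \<notin> bound_vars f" "s ''m'' 0 \<le> n"
    and ex: "i0 < s ''m'' 0" "fval f (upd s v i0)"
  shows "runs (search v f) s (1 + (ctime f n + (n * (1 + ctime f n + 1) + 1)))
    (\<lambda>s'. same_except (insert v (bound_vars f)) s s' \<and> s' v 0 < s ''m'' 0 \<and> fval f s')"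
proof -
  define B where "B = insert v (bound_vars f)"
  define J where "J s' \<longleftrightarrow> same_except B s s' \<and> s' v 0 \<le> i0" for s'
  define I where "I s' \<longleftrightarrow> J s' \<and> s' ''r'' 0 = (if fval f s' then 1 else 0)" for s'
  have mm: "s' ''m'' 0 = s ''m'' 0" if "J s'" for s'
    using that same_exceptD[of B s s' "''m''"] v m by (auto simp: J_def B_def)
  have comp: "runs (compile f 0) s1 (ctime f n) (\<lambda>s'. I s' \<and> s' v 0 = s1 v 0)" if J: "J s1" for s1
  proof (rule runs_weaken[OF _ order_refl])
    show "runs (compile f 0) s1 (ctime f n) (computed 0 f s1)"
      by (rule runs_compile[OF f(1,2) m(1)]) (use mm[OF J] m in simp)
  next
    fix s2 assume s2: "computed 0 f s1 s2"
    then have e: "same_except (bound_vars f) s1 s2" by (simp add: computed_def)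
    have "same_except (B \<union> bound_vars f) s s2" using same_except_trans e J by (auto simp: J_def)
    moreover have "B \<union> bound_vars f = B" by (auto simp: B_def)
    ultimately have "same_except B s s2" by simp
    moreover have "s2 v 0 = s1 v 0" using same_exceptD[OF e, of v] v by auto
    moreover have "fval f s2 \<longleftrightarrow> fval f s1" by (rule fval_cong[OF e f(2,3)])
    ultimately show "I s2 \<and> s2 v 0 = s1 v 0" using s2 J by (auto simp: I_def J_def computed_def)
  qed
  have loop: "runs (While (Less (Var ''r'') (Const 1)) (Seq (Assign v (Const 0) (Add (Var v) (Const 1))) (compile f 0)))
      s1 (n * (1 + ctime f n + 1) + 1) (\<lambda>s'. I s' \<and> \<not> bval (Less (Var ''r'') (Const 1)) s')" if "I s1" for s1
  proof (rule runs_While[where \<mu> = "\<lambda>s. i0 - s v 0"])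
    fix s2 assume I: "I s2" and b: "bval (Less (Var ''r'') (Const 1)) s2"
    then have nf: "\<not> fval f s2" by (auto simp: I_def split: if_splits)
    have "s2 v 0 \<noteq> i0"
    proof
      assume eq: "s2 v 0 = i0"
      have "same_except (bound_vars f) (upd s v i0) s2"
        using I eq v by (auto simp: I_def J_def same_except_def upd_def B_def)
      then have "fval f s2 \<longleftrightarrow> fval f (upd s v i0)" by (rule fval_cong[OF _ f(2,3)])
      then show False using nf ex by simp
    qed
    then have lt: "s2 v 0 < i0" using I by (simp add: I_def J_def)
    let ?s3 = "s2(v := (s2 v)(0 := s2 v 0 + 1))"
    have "J ?s3" using I lt v by (auto simp: I_def J_def same_except_def B_def)
    from comp[OF this] have "runs (compile f 0) ?s3 (ctime f n) (\<lambda>s'. I s' \<and> i0 - s' v 0 < i0 - s2 v 0)"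
      by (rule runs_weaken) (use lt in auto)
    then show "runs (Seq (Assign v (Const 0) (Add (Var v) (Const 1))) (compile f 0)) s2 (1 + ctime f n)
        (\<lambda>s'. I s' \<and> i0 - s' v 0 < i0 - s2 v 0)" by simp
  qed (use that ex m in auto)
  let ?s0 = "s(v := (s v)(0 := 0))"
  have "J ?s0" by (auto simp: J_def same_except_def B_def)
  then have "runs (Seq (compile f 0)
     (While (Less (Var ''r'') (Const 1)) (Seq (Assign v (Const 0) (Add (Var v) (Const 1))) (compile f 0))))
     ?s0 (ctime f n + (n * (1 + ctime f n + 1) + 1)) (\<lambda>s'. I s' \<and> \<not> bval (Less (Var ''r'') (Const 1)) s')"
    by (intro runs_Seq runs_weaken[OF comp order_refl] loop) auto
  then have "runs (search v f) s (1 + (ctime f n + (n * (1 + ctime f n + 1) + 1)))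
    (\<lambda>s'. I s' \<and> \<not> bval (Less (Var ''r'') (Const 1)) s')" unfolding search_def by simp
  then show ?thesis
    by (rule runs_weaken) (use ex in \<open>auto simp: I_def J_def B_def split: if_splits\<close>)
qed

definition poly_bounded :: "(nat \<Rightarrow> nat) \<Rightarrow> bool" where
  "poly_bounded T \<longleftrightarrow> (\<exists>c d. \<forall>n. T n \<le> c * (n + 1) ^ d)"

lemma poly_bounded_const: "poly_bounded (\<lambda>n. c)"
  unfolding poly_bounded_def by (intro exI[of _ c] exI[of _ 0]) simp

lemma poly_bounded_id: "poly_bounded (\<lambda>n. n)"
  unfolding poly_bounded_def by (intro exI[of _ 1]) simp

lemma poly_bounded_mult:
  assumes "poly_bounded S" "poly_bounded T" shows "poly_bounded (\<lambda>n. S n * T n)"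
proof -
  obtain c d c' d' where "\<And>n. S n \<le> c * (n + 1) ^ d" "\<And>n. T n \<le> c' * (n + 1) ^ d'"
    using assms unfolding poly_bounded_def by blast
  then have "S n * T n \<le> (c * (n + 1) ^ d) * (c' * (n + 1) ^ d')" for n by (rule mult_le_mono)
  also have "(c * (n + 1) ^ d) * (c' * (n + 1) ^ d') = (c * c') * (n + 1) ^ (d + d')" for n
    by (simp add: power_add ac_simps)
  finally show ?thesis unfolding poly_bounded_def by blast
qed

lemma poly_bounded_add:
  assumes "poly_bounded S" "poly_bounded T" shows "poly_bounded (\<lambda>n. S n + T n)"
proof -
  obtain c d c' d' where b: "\<And>n. S n \<le> c * (n + 1) ^ d" "\<And>n. T n \<le> c' * (n + 1) ^ d'"
    using assms unfolding poly_bounded_def by blast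
  have "S n + T n \<le> (c + c') * (n + 1) ^ (d + d')" for n
  proof -
    have "(n + 1) ^ d \<le> (n + 1) ^ (d + d')" "(n + 1) ^ d' \<le> (n + 1) ^ (d + d')"
      by (intro power_increasing; simp)+
    then have "c * (n + 1) ^ d \<le> c * (n + 1) ^ (d + d')" "c' * (n + 1) ^ d' \<le> c' * (n + 1) ^ (d + d')"
      by (simp_all del: power_Suc add: mult_le_mono2)
    then show ?thesis using b[of n] unfolding add_mult_distrib by linarith
  qed
  then show ?thesis unfolding poly_bounded_def by blast
qed

lemmas poly_bounded_intros = poly_bounded_const poly_bounded_id poly_bounded_mult poly_bounded_add

lemma poly_bounded_ctime: "poly_bounded (ctime f)"
  by (induction f) (auto intro!: poly_bounded_intros simp del: add_2_eq_Suc add_2_eq_Suc' One_nat_def add_Suc_right add_Suc)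

section \<open>The kernelization program\<close>

lemma runs_CondI:
  "(bval b s \<Longrightarrow> runs p s T Q) \<Longrightarrow> (\<not> bval b s \<Longrightarrow> runs q s T Q) \<Longrightarrow> runs (Cond b p q) s (T + 1) Q"
  by simp

text \<open>
  Vertex \<open>ws ! i\<close> keeps the row \<open>cl i\<close> of the original \<open>n \<times> n\<close> matrix \<open>w\<close>, and \<open>rw i\<close> caches the offset of
  that row, since the machine cannot multiply.  Deleting a vertex moves the last one into its place.
\<close>

definition rep :: "nat \<Rightarrow> 'a set set \<Rightarrow> 'a list \<Rightarrow> state \<Rightarrow> bool" where
  "rep n E ws s \<longleftrightarrow> E \<subseteq> vertex_pairs (set ws) \<and> distinct ws \<and> s ''m'' 0 = length ws \<and> length ws \<le> n \<and>
     inj_on (s ''cl'') {..<length ws} \<and>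
     (\<forall>i < length ws. s ''cl'' i < n \<and> s ''rw'' i = s ''cl'' i * n) \<and>
     (\<forall>i < length ws. \<forall>j < length ws.
        s ''w'' (s ''cl'' i * n + s ''cl'' j) = (if {ws ! i, ws ! j} \<in> E then 1 else 0))"

lemma rep_cong:
  assumes "s' ''m'' 0 = s ''m'' 0" "s' ''cl'' = s ''cl''" "s' ''rw'' = s ''rw''" "s' ''w'' = s ''w''"
  shows "rep n E ws s' \<longleftrightarrow> rep n E ws s"
  using assms by (simp add: rep_def)

lemma rep_same_except:
  assumes "rep n E ws s" "same_except B s s'" "B \<inter> {''m'', ''cl'', ''rw'', ''w''} = {}"
  shows "rep n E ws s'"
proof -
  have "s' ''m'' = s ''m''" "s' ''cl'' = s ''cl''" "s' ''rw'' = s ''rw''" "s' ''w'' = s ''w''"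
    using assms(3) by (intro same_exceptD[OF assms(2)]; auto)+
  then show ?thesis using assms(1) rep_cong by metis
qed

lemma index_inj:
  fixes a b c d n :: nat
  assumes "a * n + b = c * n + d" "b < n" "d < n"
  shows "a = c \<and> b = d"
proof -
  have "(a * n + b) div n = a" "(c * n + d) div n = c" using assms(2,3) by simp_all
  then show ?thesis using assms(1) by simp
qed

lemma rep_delete_edge:
  assumes r: "rep n E ws s" and ij: "i < length ws" "j < length ws"
    and s': "s' ''m'' 0 = s ''m'' 0" "s' ''cl'' = s ''cl''" "s' ''rw'' = s ''rw''"
      "s' ''w'' = (s ''w'')(s ''rw'' i + s ''cl'' j := 0, s ''rw'' j + s ''cl'' i := 0)"
  shows "rep n (E - {{ws ! i, ws ! j}}) ws s'"
proof -
  have d: "distinct ws" and cl: "inj_on (s ''cl'') {..<length ws}"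
    and lt: "\<And>i. i < length ws \<Longrightarrow> s ''cl'' i < n" and rw: "\<And>i. i < length ws \<Longrightarrow> s ''rw'' i = s ''cl'' i * n"
    and w: "\<And>i j. i < length ws \<Longrightarrow> j < length ws \<Longrightarrow>
      s ''w'' (s ''cl'' i * n + s ''cl'' j) = (if {ws ! i, ws ! j} \<in> E then 1 else 0)"
    using r by (auto simp: rep_def)
  have adr: "s ''cl'' p * n + s ''cl'' q = s ''cl'' p' * n + s ''cl'' q' \<longleftrightarrow> p = p' \<and> q = q'"
    if "p < length ws" "q < length ws" "p' < length ws" "q' < length ws" for p q p' q'
    using index_inj[of "s ''cl'' p" n "s ''cl'' q" "s ''cl'' p'" "s ''cl'' q'"] lt that
      inj_onD[OF cl, of p p'] inj_onD[OF cl, of q q'] by auto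
  have pr: "{ws ! p, ws ! q} = {ws ! i, ws ! j} \<longleftrightarrow> p = i \<and> q = j \<or> p = j \<and> q = i"
    if "p < length ws" "q < length ws" for p q
    using that ij d by (auto simp: doubleton_eq_iff nth_eq_iff_index_eq)
  have "s' ''w'' (s ''cl'' p * n + s ''cl'' q) = (if {ws ! p, ws ! q} \<in> E - {{ws ! i, ws ! j}} then 1 else 0)"
    if "p < length ws" "q < length ws" for p q
    using that ij adr[of p q i j] adr[of p q j i] pr[of p q] w[of p q] by (auto simp: s' rw)
  then show ?thesis using r by (auto simp: rep_def s'(1-3))
qed

lemma rep_delete_vertex:
  assumes r: "rep n E ws s" and p: "p < length ws"
    and s': "s' ''m'' 0 = s ''m'' 0 - 1" "s' ''cl'' = (s ''cl'')(p := s ''cl'' (length ws - 1))"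
      "s' ''rw'' = (s ''rw'')(p := s ''rw'' (length ws - 1))" "s' ''w'' = s ''w''"
  obtains ws' where "rep n (del_vertex E (ws ! p)) ws' s'" "set ws' = set ws - {ws ! p}"
proof -
  define L where "L = length ws - 1"
  define \<sigma> where "\<sigma> i = (if i = p then L else i)" for i
  define ws' where "ws' = map (\<lambda>i. ws ! \<sigma> i) [0..<L]"
  have d: "distinct ws" and cl: "inj_on (s ''cl'') {..<length ws}" and E: "E \<subseteq> vertex_pairs (set ws)"
    using r by (auto simp: rep_def)
  have L: "length ws = Suc L" using p by (simp add: L_def)
  have \<sigma>: "\<sigma> i < length ws" "\<sigma> i \<noteq> p" if "i < L" for i using that p L by (auto simp: \<sigma>_def)
  have inj: "inj_on \<sigma> {..<L}" by (auto simp: inj_on_def \<sigma>_def)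
  have im: "\<sigma> ` {..<L} = {..<length ws} - {p}"
  proof
    show "\<sigma> ` {..<L} \<subseteq> {..<length ws} - {p}" using \<sigma> by auto
    have "q \<in> \<sigma> ` {..<L}" if "q < length ws" "q \<noteq> p" for q
    proof (cases "q = L")
      case True
      then have "\<sigma> p = q" "p < L" using that p L by (auto simp: \<sigma>_def)
      then show ?thesis by blast
    next
      case False
      then have "\<sigma> q = q" "q < L" using that L by (auto simp: \<sigma>_def)
      then show ?thesis by force
    qed
    then show "{..<length ws} - {p} \<subseteq> \<sigma> ` {..<L}" by blast
  qed
  have injn: "inj_on ((!) ws) {..<length ws}" using d by (simp add: inj_on_def nth_eq_iff_index_eq)
  have "set ws' = (!) ws ` (\<sigma> ` {..<L})" by (auto simp: ws'_def)
  also have "\<dots> = (!) ws ` {..<length ws} - {ws ! p}"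
    unfolding im using p inj_on_image_set_diff[OF injn, of "{..<length ws}" "{p}"] by simp
  also have "(!) ws ` {..<length ws} = set ws" by (auto simp: set_conv_nth)
  finally have set: "set ws' = set ws - {ws ! p}" .
  have nth: "ws' ! i = ws ! \<sigma> i" if "i < L" for i using that by (simp add: ws'_def)
  have len: "length ws' = L" by (simp add: ws'_def)
  have cl': "s' ''cl'' i = s ''cl'' (\<sigma> i)" "s' ''rw'' i = s ''rw'' (\<sigma> i)" if "i < L" for i
    using that by (auto simp: s' \<sigma>_def L_def)
  have "distinct ws'"
    unfolding ws'_def distinct_map using inj \<sigma> d
    by (auto simp: inj_on_def nth_eq_iff_index_eq)
  moreover have "inj_on (s' ''cl'') {..<L}"
    using inj cl \<sigma> by (auto simp: inj_on_def cl')
  moreover have "del_vertex E (ws ! p) \<subseteq> vertex_pairs (set ws')"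
    using del_vertex_subset[OF E] set by simp
  moreover have "{ws ! \<sigma> i, ws ! \<sigma> j} \<in> del_vertex E (ws ! p) \<longleftrightarrow> {ws ! \<sigma> i, ws ! \<sigma> j} \<in> E"
    if "i < L" "j < L" for i j
    using \<sigma>[OF that(1)] \<sigma>[OF that(2)] d p by (simp add: del_vertex_iff nth_eq_iff_index_eq)
  ultimately have "rep n (del_vertex E (ws ! p)) ws' s'"
    using r \<sigma> unfolding rep_def len by (auto simp: cl' nth s'(1,4) L)
  then show ?thesis using that set by blast
qed

definition edF :: "vname \<Rightarrow> vname \<Rightarrow> fm" where
  "edF u v = Atom (Less (Const 0) (Cell ''w'' (Add (Cell ''rw'' (Var u)) (Cell ''cl'' (Var v)))))"

definition neqF :: "vname \<Rightarrow> vname \<Rightarrow> fm" where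
  "neqF u v = Atom (Neg (Conj (Neg (Less (Var u) (Var v))) (Neg (Less (Var v) (Var u)))))"

definition exF :: "vname \<Rightarrow> fm \<Rightarrow> fm" where
  "exF v f = MoreF v (Const 0) f"

definition orF :: "fm \<Rightarrow> fm \<Rightarrow> fm" where
  "orF f g = NotF (AndF (NotF f) (NotF g))"

definition many :: "vname \<Rightarrow> fm \<Rightarrow> fm" where
  "many v f = MoreF v (Add (Var ''b'') (Var ''b'')) f"

definition domF :: "vname \<Rightarrow> vname \<Rightarrow> fm" where
  "domF x z = NotF (exF ''y'' (AndF (edF x ''y'') (NotF (edF z ''y''))))"

definition conflictF :: "vname \<Rightarrow> vname \<Rightarrow> vname \<Rightarrow> fm" where
  "conflictF z w x = orF (AndF (edF x z) (edF x w))
     (AndF (AndF (NotF (edF x z)) (NotF (edF x w)))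
       (AndF (exF ''y'' (AndF (edF x ''y'') (NotF (edF ''y'' z))))
             (exF ''y'' (AndF (edF x ''y'') (NotF (edF ''y'' w))))))"

definition forcedF :: fm where
  "forcedF = AndF (edF ''i'' ''j'') (many ''x'' (conflictF ''i'' ''j'' ''x''))"

definition removableF :: fm where
  "removableF = orF (many ''z'' (AndF (neqF ''z'' ''x'') (AndF (domF ''x'' ''z'') (domF ''z'' ''x''))))
     (AndF (NotF (exF ''i'' (exF ''j'' (AndF (edF ''i'' ''j'') (conflictF ''i'' ''j'' ''x'')))))
       (AndF (many ''y'' (edF ''x'' ''y'')) (many ''z'' (AndF (neqF ''z'' ''x'') (domF ''x'' ''z'')))))"

lemmas fm_defs = edF_def neqF_def exF_def orF_def many_def domF_def conflictF_def

lemma upd_simps [simp]: "upd s v i v 0 = i" "u \<noteq> v \<Longrightarrow> upd s v i u = s u"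
  by (simp_all add: upd_def)

lemma rep_upd [simp]:
  "v \<notin> {''m'', ''cl'', ''rw'', ''w''} \<Longrightarrow> rep n E ws (upd s v i) \<longleftrightarrow> rep n E ws s"
  by (rule rep_cong) auto

lemma fval_edF:
  assumes "rep n E ws s" "s u 0 < length ws" "s v 0 < length ws"
  shows "fval (edF u v) s \<longleftrightarrow> {ws ! s u 0, ws ! s v 0} \<in> E"
  using assms by (auto simp: edF_def rep_def)

lemma fval_neqF [simp]: "fval (neqF u v) s \<longleftrightarrow> s u 0 \<noteq> s v 0"
  by (auto simp: neqF_def)

lemma fval_orF [simp]: "fval (orF f g) s \<longleftrightarrow> fval f s \<or> fval g s"
  by (simp add: orF_def)

lemma fval_exF [simp]: "fval (exF v f) s \<longleftrightarrow> (\<exists>i < s ''m'' 0. fval f (upd s v i))"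
proof -
  have "finite {i. i < s ''m'' 0 \<and> fval f (upd s v i)}" by simp
  then show ?thesis unfolding exF_def by (auto simp: card_gt_0_iff)
qed

lemma card_nth_filter:
  assumes "distinct ws" "\<And>i. i < length ws \<Longrightarrow> \<phi> i \<longleftrightarrow> P (ws ! i)"
  shows "card {i. i < length ws \<and> \<phi> i} = card {u \<in> set ws. P u}"
proof (rule bij_betw_same_card)
  show "bij_betw ((!) ws) {i. i < length ws \<and> \<phi> i} {u \<in> set ws. P u}"
    using assms by (auto simp: bij_betw_def inj_on_def nth_eq_iff_index_eq image_def in_set_conv_nth)
qed

lemma fval_many:
  assumes r: "rep n E ws s" and f: "\<And>i. i < length ws \<Longrightarrow> fval f (upd s v i) \<longleftrightarrow> P (ws ! i)"
  shows "fval (many v f) s \<longleftrightarrow> 2 * s ''b'' 0 < card {u \<in> set ws. P u}"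
proof -
  have "s ''m'' 0 = length ws" "distinct ws" using r by (auto simp: rep_def)
  then show ?thesis 
    using card_nth_filter[where ws = ws and \<phi> = "\<lambda>i. fval f (upd s v i)" and P = P] f
    by (simp add: many_def mult_2)
qed

lemma ex_nth_iff:
  assumes "rep n E ws s" "\<And>u. P u \<Longrightarrow> \<exists>e \<in> E. u \<in> e"
  shows "(\<exists>i < s ''m'' 0. P (ws ! i)) \<longleftrightarrow> (\<exists>u. P u)"
proof -
  have "\<Union>E \<subseteq> set ws" using assms(1) by (auto simp: rep_def vertex_pairs_def)
  then have "u \<in> set ws" if "P u" for u using assms(2)[OF that] by auto
  moreover have "s ''m'' 0 = length ws" using assms(1) by (simp add: rep_def)
  ultimately show ?thesis by (metis in_set_conv_nth)
qed

lemma rep_m: "rep n E ws s \<Longrightarrow> s ''m'' 0 = length ws"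
  by (simp add: rep_def)

lemma fval_domF:
  assumes r: "rep n E ws s" and lt: "s x 0 < length ws" "s z 0 < length ws" and ne: "x \<noteq> ''y''" "z \<noteq> ''y''"
  shows "fval (domF x z) s \<longleftrightarrow> nbh E (ws ! s x 0) \<subseteq> nbh E (ws ! s z 0)"
proof -
  have "fval (domF x z) s \<longleftrightarrow>
    \<not> (\<exists>i < s ''m'' 0. {ws ! s x 0, ws ! i} \<in> E \<and> {ws ! s z 0, ws ! i} \<notin> E)"
    using r lt ne by (simp add: domF_def rep_m fval_edF[of n E ws] cong: conj_cong)
  also have "\<dots> \<longleftrightarrow> \<not> (\<exists>u. {ws ! s x 0, u} \<in> E \<and> {ws ! s z 0, u} \<notin> E)"
    by (subst ex_nth_iff[OF r, where P = "\<lambda>u. {ws ! s x 0, u} \<in> E \<and> {ws ! s z 0, u} \<notin> E"]) auto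
  finally show ?thesis by auto
qed

lemma fval_conflictF:
  assumes r: "rep n E ws s" and lt: "s z 0 < length ws" "s w 0 < length ws" "s x 0 < length ws"
    and ne: "z \<noteq> ''y''" "w \<noteq> ''y''" "x \<noteq> ''y''"
  shows "fval (conflictF z w x) s \<longleftrightarrow> conflict E (ws ! s z 0) (ws ! s w 0) (ws ! s x 0)"
proof -
  have ex: "fval (exF ''y'' (AndF (edF x ''y'') (NotF (edF ''y'' v)))) s \<longleftrightarrow>
      (\<exists>y. {ws ! s x 0, y} \<in> E \<and> {y, ws ! s v 0} \<notin> E)"
    if "s v 0 < length ws" "v \<noteq> ''y''" for v
  proof -
    have "fval (exF ''y'' (AndF (edF x ''y'') (NotF (edF ''y'' v)))) s \<longleftrightarrow>
      (\<exists>i < s ''m'' 0. {ws ! s x 0, ws ! i} \<in> E \<and> {ws ! i, ws ! s v 0} \<notin> E)"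
      using r lt ne that by (simp add: rep_m fval_edF[of n E ws] cong: conj_cong)
    also have "\<dots> \<longleftrightarrow> (\<exists>y. {ws ! s x 0, y} \<in> E \<and> {y, ws ! s v 0} \<notin> E)"
      by (rule ex_nth_iff[OF r]) auto
    finally show ?thesis .
  qed
  show ?thesis
    unfolding conflictF_def conflict_def fval_orF fval.simps
    using fval_edF[OF r] ex lt ne by simp
qed

lemma fval_forcedF:
  assumes r: "rep n E ws s" and lt: "s ''i'' 0 < length ws" "s ''j'' 0 < length ws"
  shows "fval forcedF s \<longleftrightarrow> forced_edge E (set ws) (s ''b'' 0) (ws ! s ''i'' 0) (ws ! s ''j'' 0)"
proof -
  have "fval (conflictF ''i'' ''j'' ''x'') (upd s ''x'' l) \<longleftrightarrow>
      conflict E (ws ! s ''i'' 0) (ws ! s ''j'' 0) (ws ! l)" if "l < length ws" for l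
    using that lt r by (subst fval_conflictF[of n E ws]) auto
  then show ?thesis
    unfolding forcedF_def forced_edge_def fval.simps
    using fval_many[OF r, of "conflictF ''i'' ''j'' ''x''" "''x''"] fval_edF[OF r lt] by auto
qed

lemma fval_removableF:
  assumes r: "rep n E ws s" and lt: "s ''x'' 0 < length ws"
  shows "fval removableF s \<longleftrightarrow> removable E (set ws) (s ''b'' 0) (ws ! s ''x'' 0)"
proof -
  let ?x = "ws ! s ''x'' 0"
  have d: "distinct ws" and m: "s ''m'' 0 = length ws" and E: "E \<subseteq> vertex_pairs (set ws)"
    using r by (auto simp: rep_def)
  have ne: "ws ! l \<noteq> ?x \<longleftrightarrow> l \<noteq> s ''x'' 0" if "l < length ws" for l
    using d lt that by (simp add: nth_eq_iff_index_eq)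
  have dom: "fval (domF ''x'' ''z'') (upd s ''z'' l) \<longleftrightarrow> nbh E ?x \<subseteq> nbh E (ws ! l)"
    "fval (domF ''z'' ''x'') (upd s ''z'' l) \<longleftrightarrow> nbh E (ws ! l) \<subseteq> nbh E ?x" if "l < length ws" for l
    using that lt r by (subst fval_domF[of n E ws]; simp)+
  have tw: "fval (many ''z'' (AndF (neqF ''z'' ''x'') (AndF (domF ''x'' ''z'') (domF ''z'' ''x'')))) s \<longleftrightarrow>
      2 * s ''b'' 0 < card (twins E (set ws) ?x)"
    unfolding twins_def by (rule fval_many[OF r]) (auto simp: dom ne)
  have dm: "fval (many ''z'' (AndF (neqF ''z'' ''x'') (domF ''x'' ''z''))) s \<longleftrightarrow>
      2 * s ''b'' 0 < card (dominators E (set ws) ?x)"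
    unfolding dominators_def by (rule fval_many[OF r]) (auto simp: dom ne)
  have "fval (many ''y'' (edF ''x'' ''y'')) s \<longleftrightarrow> 2 * s ''b'' 0 < card {u \<in> set ws. {?x, u} \<in> E}"
    by (rule fval_many[OF r]) (use r lt in \<open>simp add: fval_edF[of n E ws]\<close>)
  moreover have "{u \<in> set ws. {?x, u} \<in> E} = nbh E ?x" using nbh_subset[OF E] by (auto simp: nbh_def)
  ultimately have nb: "fval (many ''y'' (edF ''x'' ''y'')) s \<longleftrightarrow> 2 * s ''b'' 0 < card (nbh E ?x)" by simp
  have "fval (exF ''i'' (exF ''j'' (AndF (edF ''i'' ''j'') (conflictF ''i'' ''j'' ''x'')))) s \<longleftrightarrow>
      (\<exists>a < length ws. \<exists>c < length ws. {ws ! a, ws ! c} \<in> E \<and> conflict E (ws ! a) (ws ! c) ?x)"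
    using r lt m by (simp add: fval_edF[of n E ws] fval_conflictF[of n E ws] cong: conj_cong)
  also have "\<dots> \<longleftrightarrow> (\<exists>z w. {z, w} \<in> E \<and> conflict E z w ?x)"
    using vertex_pairs_edgeD(1,2)[OF E] by (metis in_set_conv_nth)
  finally show ?thesis unfolding removableF_def removable_def fval_orF fval.simps
    using tw dm nb by auto
qed

definition any_forcedF :: fm where "any_forcedF = exF ''i'' (exF ''j'' forcedF)"
definition any_removableF :: fm where "any_removableF = exF ''x'' removableF"

lemma forcedF_wf:
  "compilable forcedF" "scratch_free forcedF" "bound_vars forcedF = {''x'', ''y''}"
  "free_vars forcedF = {''w'', ''rw'', ''cl'', ''i'', ''j'', ''b'', ''m''}"
  by (auto simp: forcedF_def fm_defs)

lemma removableF_wf: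
  "compilable removableF" "scratch_free removableF" "bound_vars removableF = {''z'', ''y'', ''i'', ''j''}"
  "free_vars removableF = {''w'', ''rw'', ''cl'', ''x'', ''b'', ''m''}"
  by (auto simp: removableF_def fm_defs)

lemma ex_forcedF_wf:
  "compilable (exF ''j'' forcedF)" "scratch_free (exF ''j'' forcedF)"
  "bound_vars (exF ''j'' forcedF) = {''j'', ''x'', ''y''}"
  "free_vars (exF ''j'' forcedF) = {''w'', ''rw'', ''cl'', ''i'', ''b'', ''m''}"
  by (auto simp: exF_def forcedF_wf)

lemma any_forcedF_wf:
  "compilable any_forcedF" "scratch_free any_forcedF" "bound_vars any_forcedF = {''i'', ''j'', ''x'', ''y''}"
  using ex_forcedF_wf by (auto simp: exF_def[of "''i''"] any_forcedF_def)

lemma any_removableF_wf: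
  "compilable any_removableF" "scratch_free any_removableF"
  "bound_vars any_removableF = {''x'', ''z'', ''y'', ''i'', ''j''}"
  using removableF_wf by (auto simp: exF_def any_removableF_def)

definition search_time :: "fm \<Rightarrow> nat \<Rightarrow> nat" where
  "search_time f n = 1 + (ctime f n + (n * (1 + ctime f n + 1) + 1))"

definition step_edge :: com where
  "step_edge = Seq (search ''i'' (exF ''j'' forcedF)) (Seq (search ''j'' forcedF)
     (Cond (Less (Var ''b'') (Const 1))
       (Seq (Assign ''no'' (Const 0) (Const 1)) (Assign ''go'' (Const 0) (Const 0)))
       (Seq (Assign ''w'' (Add (Cell ''rw'' (Var ''i'')) (Cell ''cl'' (Var ''j''))) (Const 0))
       (Seq (Assign ''w'' (Add (Cell ''rw'' (Var ''j'')) (Cell ''cl'' (Var ''i''))) (Const 0))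
            (Assign ''b'' (Const 0) (Sub (Var ''b'') (Const 1)))))))"

definition step_vertex :: com where
  "step_vertex = Seq (search ''x'' removableF) (Seq (Assign ''m'' (Const 0) (Sub (Var ''m'') (Const 1)))
     (Seq (Assign ''cl'' (Var ''x'') (Cell ''cl'' (Var ''m''))) (Assign ''rw'' (Var ''x'') (Cell ''rw'' (Var ''m'')))))"

definition step :: com where
  "step = Seq (compile any_forcedF 0) (Cond (Less (Const 0) (Var ''r'')) step_edge
     (Seq (compile any_removableF 0) (Cond (Less (Const 0) (Var ''r'')) step_vertex
        (Assign ''go'' (Const 0) (Const 0)))))"

definition step_time :: "nat \<Rightarrow> nat" where
  "step_time n = ctime any_forcedF n + ((search_time (exF ''j'' forcedF) n + (search_time forcedF n + 4)) +
     (ctime any_removableF n + (search_time removableF n + 4)) + 1)"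

text \<open>\<open>A\<close> is the answer for the input; the flag \<open>no\<close> records that it is negative.\<close>

definition reducing :: "nat \<Rightarrow> nat \<Rightarrow> bool \<Rightarrow> nat set set \<Rightarrow> nat list \<Rightarrow> state \<Rightarrow> bool" where
  "reducing n k A E ws s \<longleftrightarrow> rep n E ws s \<and> s ''b'' 0 \<le> k \<and>
     (if s ''no'' 0 = 0 then A \<longleftrightarrow> chain_deletion E (s ''b'' 0) else \<not> A) \<and>
     (0 < s ''go'' 0 \<longrightarrow> s ''no'' 0 = 0) \<and> s ''go'' 0 \<le> 1"

definition reduced :: "nat set set \<Rightarrow> nat list \<Rightarrow> state \<Rightarrow> bool" where
  "reduced E ws s \<longleftrightarrow> (\<forall>z \<in> set ws. \<forall>w \<in> set ws. \<not> forced_edge E (set ws) (s ''b'' 0) z w) \<and>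
     (\<forall>x \<in> set ws. \<not> removable E (set ws) (s ''b'' 0) x)"

definition step_inv :: "nat \<Rightarrow> nat \<Rightarrow> bool \<Rightarrow> state \<Rightarrow> bool" where
  "step_inv n k A s \<longleftrightarrow> (\<exists>E ws. reducing n k A E ws s \<and> (s ''go'' 0 = 0 \<longrightarrow> s ''no'' 0 = 0 \<longrightarrow> reduced E ws s))"

lemma same_except_reducing:
  assumes "reducing n k A E ws s" "same_except B s s'"
    "B \<inter> {''m'', ''cl'', ''rw'', ''w'', ''b'', ''no'', ''go''} = {}"
  shows "reducing n k A E ws s'"
proof -
  have "s' ''b'' = s ''b''" "s' ''no'' = s ''no''" "s' ''go'' = s ''go''"
    using assms(3) by (intro same_exceptD[OF assms(2)]; auto)+
  moreover have "rep n E ws s'"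
    by (rule rep_same_except[OF _ assms(2)]) (use assms(1,3) in \<open>auto simp: reducing_def\<close>)
  ultimately show ?thesis using assms(1) by (simp add: reducing_def)
qed

lemma forced_edge_step:
  assumes "rep n E ws s" "forced_edge E (set ws) k z w"
  shows "chain_deletion E k \<longleftrightarrow> 0 < k \<and> chain_deletion (E - {{z, w}}) (k - 1)"
  using assms by (intro chain_deletion_forced[of E "set ws"]) (auto simp: rep_def forced_edge_def)

lemma runs_step_edge:
  assumes red: "reducing n k A E ws s" and go: "s ''go'' 0 = 1" and f: "fval any_forcedF s"
  shows "runs step_edge s (search_time (exF ''j'' forcedF) n + (search_time forcedF n + 4))
    (\<lambda>s'. step_inv n k A s' \<and> s' ''go'' 0 + s' ''m'' 0 + s' ''b'' 0 < s ''go'' 0 + s ''m'' 0 + s ''b'' 0)"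
proof -
  have mn: "s ''m'' 0 \<le> n" using red by (auto simp: reducing_def rep_def)
  obtain i0 where i0: "i0 < s ''m'' 0" "fval (exF ''j'' forcedF) (upd s ''i'' i0)"
    using f unfolding any_forcedF_def fval_exF[of "''i''"] by blast
  have r1: "runs (search ''i'' (exF ''j'' forcedF)) s (search_time (exF ''j'' forcedF) n)
     (\<lambda>s'. same_except {''i'', ''j'', ''x'', ''y''} s s' \<and> s' ''i'' 0 < s ''m'' 0 \<and> fval (exF ''j'' forcedF) s')"
    unfolding search_time_def
    by (rule runs_weaken[OF runs_search[OF ex_forcedF_wf(1,2) _ _ _ _ mn i0]])
      (auto simp: ex_forcedF_wf)
  show ?thesis unfolding step_edge_def
  proof (intro runs_Seq runs_weaken[OF r1 order_refl], elim conjE)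
    fix s1 assume e1: "same_except {''i'', ''j'', ''x'', ''y''} s s1" and i1: "s1 ''i'' 0 < s ''m'' 0"
      and f1: "fval (exF ''j'' forcedF) s1"
    have m1: "s1 ''m'' = s ''m''" by (rule same_exceptD[OF e1]) auto
    then have mn1: "s1 ''m'' 0 \<le> n" using mn by simp
    obtain j0 where j0: "j0 < s1 ''m'' 0" "fval forcedF (upd s1 ''j'' j0)" using f1 by auto
    have r2: "runs (search ''j'' forcedF) s1 (search_time forcedF n)
     (\<lambda>s'. same_except {''j'', ''x'', ''y''} s1 s' \<and> s' ''j'' 0 < s ''m'' 0 \<and> fval forcedF s')"
      unfolding search_time_def
      by (rule runs_weaken[OF runs_search[OF forcedF_wf(1,2) _ _ _ _ mn1 j0]])
        (auto simp: forcedF_wf m1)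
    show "runs (search ''j'' forcedF) s1 (search_time forcedF n) (\<lambda>s2. runs (Cond (Less (Var ''b'') (Const 1))
       (Seq (Assign ''no'' (Const 0) (Const 1)) (Assign ''go'' (Const 0) (Const 0)))
       (Seq (Assign ''w'' (Add (Cell ''rw'' (Var ''i'')) (Cell ''cl'' (Var ''j''))) (Const 0))
       (Seq (Assign ''w'' (Add (Cell ''rw'' (Var ''j'')) (Cell ''cl'' (Var ''i''))) (Const 0))
            (Assign ''b'' (Const 0) (Sub (Var ''b'') (Const 1)))))) s2 4
      (\<lambda>s'. step_inv n k A s' \<and> s' ''go'' 0 + s' ''m'' 0 + s' ''b'' 0 < s ''go'' 0 + s ''m'' 0 + s ''b'' 0))"
    proof (intro runs_weaken[OF r2 order_refl], elim conjE)
      fix s2 assume e2: "same_except {''j'', ''x'', ''y''} s1 s2" and j2: "s2 ''j'' 0 < s ''m'' 0"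
        and f2: "fval forcedF s2"
      have e: "same_except {''i'', ''j'', ''x'', ''y''} s s2"
        by (rule same_except_mono[OF same_except_trans[OF e1 e2]]) auto
      have red2: "reducing n k A E ws s2" by (rule same_except_reducing[OF red e]) auto
      have eq: "s2 ''go'' = s ''go''" "s2 ''b'' = s ''b''" "s2 ''m'' = s ''m''"
        by (rule same_exceptD[OF e]; simp)+
      have "s2 ''i'' = s1 ''i''" by (rule same_exceptD[OF e2]) auto
      then have i2: "s2 ''i'' 0 < length ws" and j2': "s2 ''j'' 0 < length ws"
        using i1 j2 red by (auto simp: reducing_def rep_def)
      have rep2: "rep n E ws s2" using red2 by (simp add: reducing_def)
      let ?z = "ws ! s2 ''i'' 0" and ?w = "ws ! s2 ''j'' 0"
      have fe: "forced_edge E (set ws) (s2 ''b'' 0) ?z ?w" using f2 fval_forcedF[OF rep2 i2 j2'] by simp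
      note step = forced_edge_step[OF rep2 fe]
      have A: "A \<longleftrightarrow> chain_deletion E (s2 ''b'' 0)" "s2 ''no'' 0 = 0"
        using red2 go eq by (auto simp: reducing_def)
      show "runs (Cond (Less (Var ''b'') (Const 1))
       (Seq (Assign ''no'' (Const 0) (Const 1)) (Assign ''go'' (Const 0) (Const 0)))
       (Seq (Assign ''w'' (Add (Cell ''rw'' (Var ''i'')) (Cell ''cl'' (Var ''j''))) (Const 0))
       (Seq (Assign ''w'' (Add (Cell ''rw'' (Var ''j'')) (Cell ''cl'' (Var ''i''))) (Const 0))
            (Assign ''b'' (Const 0) (Sub (Var ''b'') (Const 1)))))) s2 4
        (\<lambda>s'. step_inv n k A s' \<and> s' ''go'' 0 + s' ''m'' 0 + s' ''b'' 0 < s ''go'' 0 + s ''m'' 0 + s ''b'' 0)"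
      proof (cases "s2 ''b'' 0 = 0")
        case True
        let ?s3 = "s2(''no'' := (s2 ''no'')(0 := 1), ''go'' := (s2 ''go'')(0 := 0))"
        have "rep n E ws ?s3" using rep2 rep_cong[of ?s3 s2 n E ws] by simp
        then have "reducing n k A E ws ?s3"
          using red2 A step True by (simp add: reducing_def)
        then have "step_inv n k A ?s3" unfolding step_inv_def by (intro exI[of _ E] exI[of _ ws]) simp
        then show ?thesis using True eq go by simp
      next
        case False
        let ?w' = "(s2 ''w'')(s2 ''rw'' (s2 ''i'' 0) + s2 ''cl'' (s2 ''j'' 0) := 0,
          s2 ''rw'' (s2 ''j'' 0) + s2 ''cl'' (s2 ''i'' 0) := 0)"
        let ?s3 = "s2(''w'' := ?w', ''b'' := (s2 ''b'')(0 := s2 ''b'' 0 - 1))"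
        have "rep n (E - {{?z, ?w}}) ws ?s3" by (rule rep_delete_edge[OF rep2 i2 j2']) simp_all
        then have "reducing n k A (E - {{?z, ?w}}) ws ?s3"
          using red2 A step False by (auto simp: reducing_def)
        then have "step_inv n k A ?s3"
          using eq go unfolding step_inv_def by (intro exI[of _ "E - {{?z, ?w}}"] exI[of _ ws]) simp
        then show ?thesis using False eq by simp
      qed
    qed
  qed
qed

lemma runs_step_vertex:
  assumes red: "reducing n k A E ws s" and go: "s ''go'' 0 = 1" and f: "fval any_removableF s"
  shows "runs step_vertex s (search_time removableF n + 3)
    (\<lambda>s'. step_inv n k A s' \<and> s' ''go'' 0 + s' ''m'' 0 + s' ''b'' 0 < s ''go'' 0 + s ''m'' 0 + s ''b'' 0)"
proof -
  have mn: "s ''m'' 0 \<le> n" using red by (auto simp: reducing_def rep_def)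
  obtain i0 where i0: "i0 < s ''m'' 0" "fval removableF (upd s ''x'' i0)"
    using f unfolding any_removableF_def by auto
  have r1: "runs (search ''x'' removableF) s (search_time removableF n)
     (\<lambda>s'. same_except {''i'', ''j'', ''x'', ''y'', ''z''} s s' \<and> s' ''x'' 0 < s ''m'' 0 \<and> fval removableF s')"
    unfolding search_time_def
    by (rule runs_weaken[OF runs_search[OF removableF_wf(1,2) _ _ _ _ mn i0]])
      (auto simp: removableF_wf elim!: same_except_mono)
  show ?thesis unfolding step_vertex_def
  proof (intro runs_Seq runs_weaken[OF r1 order_refl], elim conjE)
    fix s2 assume e: "same_except {''i'', ''j'', ''x'', ''y'', ''z''} s s2" and x: "s2 ''x'' 0 < s ''m'' 0"
      and f2: "fval removableF s2"
    have red2: "reducing n k A E ws s2" by (rule same_except_reducing[OF red e]) auto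
    have eq: "s2 ''go'' = s ''go''" "s2 ''b'' = s ''b''" "s2 ''m'' = s ''m''"
      by (rule same_exceptD[OF e]; simp)+
    have rep2: "rep n E ws s2" using red2 by (simp add: reducing_def)
    have m2: "s2 ''m'' 0 = length ws" by (rule rep_m[OF rep2])
    have x2: "s2 ''x'' 0 < length ws" using x eq m2 by simp
    let ?x = "ws ! s2 ''x'' 0"
    have "removable E (set ws) (s2 ''b'' 0) ?x" using f2 fval_removableF[OF rep2 x2] by simp
    then have step: "chain_deletion E (s2 ''b'' 0) \<longleftrightarrow> chain_deletion (del_vertex E ?x) (s2 ''b'' 0)"
      using rep2 x2 by (intro chain_deletion_removable[of E "set ws"]) (auto simp: rep_def)
    let ?s3 = "s2(''m'' := (s2 ''m'')(0 := length ws - 1),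
      ''cl'' := (s2 ''cl'')(s2 ''x'' 0 := s2 ''cl'' (length ws - 1)),
      ''rw'' := (s2 ''rw'')(s2 ''x'' 0 := s2 ''rw'' (length ws - 1)))"
    obtain ws' where ws': "rep n (del_vertex E ?x) ws' ?s3"
      by (rule rep_delete_vertex[OF rep2 x2, of ?s3]) (simp_all add: m2)
    have "A \<longleftrightarrow> chain_deletion E (s2 ''b'' 0)" "s2 ''no'' 0 = 0"
      using red2 go eq by (auto simp: reducing_def)
    then have "reducing n k A (del_vertex E ?x) ws' ?s3"
      using ws' red2 step by (simp add: reducing_def)
    then have "step_inv n k A ?s3"
      using eq go unfolding step_inv_def by (intro exI[of _ "del_vertex E ?x"] exI[of _ ws']) simp
    then show "runs (Seq (Assign ''m'' (Const 0) (Sub (Var ''m'') (Const 1)))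
     (Seq (Assign ''cl'' (Var ''x'') (Cell ''cl'' (Var ''m''))) (Assign ''rw'' (Var ''x'') (Cell ''rw'' (Var ''m'')))))
      s2 3 (\<lambda>s'. step_inv n k A s' \<and> s' ''go'' 0 + s' ''m'' 0 + s' ''b'' 0 < s ''go'' 0 + s ''m'' 0 + s ''b'' 0)"
      using eq m2 x2 by simp
  qed
qed

lemma runs_step:
  assumes inv: "step_inv n k A s" and go: "s ''go'' 0 = 1"
  shows "runs step s (step_time n)
    (\<lambda>s'. step_inv n k A s' \<and> s' ''go'' 0 + s' ''m'' 0 + s' ''b'' 0 < s ''go'' 0 + s ''m'' 0 + s ''b'' 0)"
proof -
  let ?Q = "\<lambda>s'. step_inv n k A s' \<and> s' ''go'' 0 + s' ''m'' 0 + s' ''b'' 0 < s ''go'' 0 + s ''m'' 0 + s ''b'' 0"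
  obtain E ws where red: "reducing n k A E ws s" using inv by (auto simp: step_inv_def)
  have rep: "rep n E ws s" using red by (simp add: reducing_def)
  have mn: "s ''m'' 0 \<le> n" using rep by (auto simp: rep_def)
  have c1: "runs (compile any_forcedF 0) s (ctime any_forcedF n) (computed 0 any_forcedF s)"
    by (rule runs_compile[OF any_forcedF_wf(1,2)]) (simp_all add: any_forcedF_wf mn)
  show ?thesis unfolding step_def step_time_def
  proof (intro runs_Seq runs_weaken[OF c1 order_refl])
    fix s1 assume s1: "computed 0 any_forcedF s s1"
    then have e1: "same_except {''i'', ''j'', ''x'', ''y''} s s1" by (simp add: computed_def any_forcedF_wf)
    have red1: "reducing n k A E ws s1" by (rule same_except_reducing[OF red e1]) auto
    have eq1: "s1 ''go'' = s ''go''" "s1 ''b'' = s ''b''" "s1 ''m'' = s ''m''"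
      by (rule same_exceptD[OF e1]; simp)+
    have fv1: "fval any_forcedF s1 \<longleftrightarrow> fval any_forcedF s"
      by (rule fval_cong[OF e1 any_forcedF_wf(2)]) (auto simp: any_forcedF_def exF_def forcedF_wf)
    have mn1: "s1 ''m'' 0 \<le> n" using mn eq1 by simp
    have c2: "runs (compile any_removableF 0) s1 (ctime any_removableF n) (computed 0 any_removableF s1)"
      by (rule runs_compile[OF any_removableF_wf(1,2)]) (simp_all add: any_removableF_wf mn1)
    show "runs (Cond (Less (Const 0) (Var ''r'')) step_edge
     (Seq (compile any_removableF 0) (Cond (Less (Const 0) (Var ''r'')) step_vertex
        (Assign ''go'' (Const 0) (Const 0))))) s1
      ((search_time (exF ''j'' forcedF) n + (search_time forcedF n + 4)) +
     (ctime any_removableF n + (search_time removableF n + 4)) + 1) ?Q"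
    proof (rule runs_CondI)
      assume "bval (Less (Const 0) (Var ''r'')) s1"
      then have "fval any_forcedF s1" using s1 fv1 by (auto simp: computed_def split: if_splits)
      from runs_step_edge[OF red1 _ this] show "runs step_edge s1
        ((search_time (exF ''j'' forcedF) n + (search_time forcedF n + 4)) +
        (ctime any_removableF n + (search_time removableF n + 4))) ?Q"
        by (rule runs_weaken) (use go eq1 in auto)
    next
      assume "\<not> bval (Less (Const 0) (Var ''r'')) s1"
      then have nf: "\<not> fval any_forcedF s" using s1 by (auto simp: computed_def split: if_splits)
      have "runs (Seq (compile any_removableF 0) (Cond (Less (Const 0) (Var ''r'')) step_vertex
        (Assign ''go'' (Const 0) (Const 0)))) s1
        (ctime any_removableF n + ((search_time removableF n + 3) + 1)) ?Q"
      proof (intro runs_Seq runs_weaken[OF c2 order_refl])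
        fix s2 assume s2: "computed 0 any_removableF s1 s2"
        then have e2: "same_except {''x'', ''z'', ''y'', ''i'', ''j''} s1 s2"
          by (simp add: computed_def any_removableF_wf)
        have red2: "reducing n k A E ws s2" by (rule same_except_reducing[OF red1 e2]) auto
        have eq2: "s2 ''go'' = s1 ''go''" "s2 ''b'' = s1 ''b''" "s2 ''m'' = s1 ''m''"
          by (rule same_exceptD[OF e2]; simp)+
        have fv2: "fval any_removableF s2 \<longleftrightarrow> fval any_removableF s1"
          by (rule fval_cong[OF e2 any_removableF_wf(2)]) (auto simp: any_removableF_def exF_def removableF_wf)
        show "runs (Cond (Less (Const 0) (Var ''r'')) step_vertex (Assign ''go'' (Const 0) (Const 0))) s2
          ((search_time removableF n + 3) + 1) ?Q"
        proof (rule runs_CondI)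
          assume "bval (Less (Const 0) (Var ''r'')) s2"
          then have "fval any_removableF s2" using s2 fv2 by (auto simp: computed_def split: if_splits)
          from runs_step_vertex[OF red2 _ this] show "runs step_vertex s2 (search_time removableF n + 3) ?Q"
            by (rule runs_weaken) (use go eq1 eq2 in auto)
        next
          assume "\<not> bval (Less (Const 0) (Var ''r'')) s2"
          then have nr: "\<not> fval any_removableF s1" using s2 by (auto simp: computed_def split: if_splits)
          have rep1: "rep n E ws s1" and rep2: "rep n E ws s2"
            using red1 red2 by (auto simp: reducing_def)
          let ?s3 = "s2(''go'' := (s2 ''go'')(0 := 0))"
          have "reduced E ws ?s3" unfolding reduced_def
          proof (intro conjI ballI)
            fix z w assume "z \<in> set ws" "w \<in> set ws"
            then obtain a c where ac: "a < length ws" "ws ! a = z" "c < length ws" "ws ! c = w"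
              by (metis in_set_conv_nth)
            have "\<not> fval forcedF (upd (upd s ''i'' a) ''j'' c)"
              using nf ac rep_m[OF rep] unfolding any_forcedF_def by auto
            then show "\<not> forced_edge E (set ws) (?s3 ''b'' 0) z w"
              using ac fval_forcedF[of n E ws "upd (upd s ''i'' a) ''j'' c"] rep eq1 eq2 by auto
          next
            fix x assume "x \<in> set ws"
            then obtain a where a: "a < length ws" "ws ! a = x" by (metis in_set_conv_nth)
            have "\<not> fval removableF (upd s1 ''x'' a)"
              using nr a rep_m[OF rep1] unfolding any_removableF_def by auto
            then show "\<not> removable E (set ws) (?s3 ''b'' 0) x"
              using a fval_removableF[of n E ws "upd s1 ''x'' a"] rep1 eq2 by auto
          qed
          moreover have "rep n E ws ?s3" using rep2 rep_cong[of ?s3 s2 n E ws] by simp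
          then have "reducing n k A E ws ?s3" using red2 by (simp add: reducing_def)
          ultimately have "step_inv n k A ?s3" unfolding step_inv_def by blast
          then show "runs (Assign ''go'' (Const 0) (Const 0)) s2 (search_time removableF n + 3) ?Q"
            using go eq1 eq2 by simp
        qed
      qed
      then show "runs (Seq (compile any_removableF 0) (Cond (Less (Const 0) (Var ''r'')) step_vertex
        (Assign ''go'' (Const 0) (Const 0)))) s1
        ((search_time (exF ''j'' forcedF) n + (search_time forcedF n + 4)) +
        (ctime any_removableF n + (search_time removableF n + 4))) ?Q"
        by (rule runs_weaken) auto
    qed
  qed
qed

definition fill :: "vname \<Rightarrow> vname \<Rightarrow> bexp \<Rightarrow> com" where
  "fill dst N b = Seq (Assign ''p'' (Const 0) (Const 0)) (Seq (Assign ''i'' (Const 0) (Const 0))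
    (While (Less (Var ''i'') (Var N)) (Seq (Assign ''j'' (Const 0) (Const 0))
      (Seq (While (Less (Var ''j'') (Var N))
         (Seq (Cond b (Assign dst (Var ''p'') (Const 1)) (Assign dst (Var ''p'') (Const 0)))
           (Seq (Assign ''p'' (Const 0) (Add (Var ''p'') (Const 1)))
                (Assign ''j'' (Const 0) (Add (Var ''j'') (Const 1))))))
       (Assign ''i'' (Const 0) (Add (Var ''i'') (Const 1)))))))"

definition fill_time :: "nat \<Rightarrow> nat" where
  "fill_time n = 2 + (n * (1 + ((n * ((2 + 2) + 1) + 1) + 1) + 1) + 1)"

definition agree_off :: "vname set \<Rightarrow> state \<Rightarrow> state \<Rightarrow> bool" where
  "agree_off A s s' \<longleftrightarrow> (\<forall>x. x \<notin> A \<longrightarrow> s' x = s x)"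

lemma agree_off_refl [simp]: "agree_off A s s"
  by (simp add: agree_off_def)

lemma agree_off_upd [simp]: "x \<in> A \<Longrightarrow> agree_off A s (s'(x := g)) \<longleftrightarrow> agree_off A s s'"
  by (auto simp: agree_off_def)

lemma agree_offD: "agree_off A s s' \<Longrightarrow> x \<notin> A \<Longrightarrow> s' x = s x"
  by (simp add: agree_off_def)

lemma runs_fill:
  assumes nm: "dst \<notin> {''p'', ''i'', ''j'', N}" "N \<notin> {''p'', ''i'', ''j''}"
    and b: "\<And>s' i j. agree_off {''p'', ''i'', ''j'', dst} s s' \<Longrightarrow> s' ''i'' 0 = i \<Longrightarrow> s' ''j'' 0 = j \<Longrightarrow>
      s' ''p'' 0 = i * s N 0 + j \<Longrightarrow> i < s N 0 \<Longrightarrow> j < s N 0 \<Longrightarrow> bval b s' \<longleftrightarrow> \<beta> i j"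
  shows "runs (fill dst N b) s (fill_time (s N 0)) (\<lambda>s'. agree_off {''p'', ''i'', ''j'', dst} s s' \<and>
    (\<forall>i < s N 0. \<forall>j < s N 0. s' dst (i * s N 0 + j) = (if \<beta> i j then 1 else 0)))"
proof -
  define n where "n = s N 0"
  define \<gamma> where "\<gamma> q = (if \<beta> (q div n) (q mod n) then 1 else 0 :: nat)" for q
  define J where "J i j s' \<longleftrightarrow> agree_off {''p'', ''i'', ''j'', dst} s s' \<and> s' ''i'' 0 = i \<and>
    s' ''j'' 0 = j \<and> s' ''p'' 0 = i * n + j \<and> (\<forall>q < i * n + j. s' dst q = \<gamma> q)" for i j s'
  define I where "I i s' \<longleftrightarrow> J i 0 (s'(''j'' := (s' ''j'')(0 := 0)))" for i s'
  have NJ: "s' N = s N" if "J i j s'" for i j s'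
    using that nm by (intro agree_offD[of "{''p'', ''i'', ''j'', dst}"]) (auto simp: J_def)
  let ?inner = "Seq (Cond b (Assign dst (Var ''p'') (Const 1)) (Assign dst (Var ''p'') (Const 0)))
           (Seq (Assign ''p'' (Const 0) (Add (Var ''p'') (Const 1)))
                (Assign ''j'' (Const 0) (Add (Var ''j'') (Const 1))))"
  have inner: "runs ?inner s1 (2 + 2) (J i (Suc j))" if J: "J i j s1" and ij: "i < n" "j < n" for i j s1
  proof (rule runs_Seq)
    have bv: "bval b s1 \<longleftrightarrow> \<beta> i j"
      by (rule b) (use J ij in \<open>auto simp: J_def n_def\<close>)
    have "(i * n + j) div n = i" "(i * n + j) mod n = j" using ij by simp_all
    then have \<gamma>: "\<gamma> (i * n + j) = (if \<beta> i j then 1 else 0)" by (simp add: \<gamma>_def)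
    show "runs (Cond b (Assign dst (Var ''p'') (Const 1)) (Assign dst (Var ''p'') (Const 0))) s1 2
      (\<lambda>s'. runs (Seq (Assign ''p'' (Const 0) (Add (Var ''p'') (Const 1)))
                (Assign ''j'' (Const 0) (Add (Var ''j'') (Const 1)))) s' 2 (J i (Suc j)))"
      using J nm bv \<gamma> by (auto simp: J_def less_Suc_eq)
  qed
  have loop: "runs (While (Less (Var ''j'') (Var N)) ?inner) s1 (n * ((2 + 2) + 1) + 1) (J i n)"
    if "J i 0 s1" "i < n" for i s1
  proof (rule runs_for)
    fix j s' assume J: "J i j s'"
    then show "bval (Less (Var ''j'') (Var N)) s' \<longleftrightarrow> j < n" using NJ[OF J] by (simp add: J_def n_def)
  qed (use inner that in auto)
  have outer: "runs (While (Less (Var ''i'') (Var N)) (Seq (Assign ''j'' (Const 0) (Const 0))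
      (Seq (While (Less (Var ''j'') (Var N)) ?inner) (Assign ''i'' (Const 0) (Add (Var ''i'') (Const 1))))))
      s1 (n * (1 + ((n * ((2 + 2) + 1) + 1) + 1) + 1) + 1) (I n)" if "I 0 s1" for s1
  proof (rule runs_for)
    fix i s' assume I: "I i s'"
    then have "s' N = s N" using NJ[of i 0 "s'(''j'' := (s' ''j'')(0 := 0))"] nm by (simp add: I_def)
    then show "bval (Less (Var ''i'') (Var N)) s' \<longleftrightarrow> i < n" using I by (simp add: I_def J_def n_def)
  next
    fix i s' assume i: "i < n" and I: "I i s'"
    let ?s = "s'(''j'' := (s' ''j'')(0 := 0))"
    have J: "J i 0 ?s" using I by (simp add: I_def)
    have "runs (Seq (While (Less (Var ''j'') (Var N)) ?inner) (Assign ''i'' (Const 0) (Add (Var ''i'') (Const 1))))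
      ?s ((n * ((2 + 2) + 1) + 1) + 1) (I (Suc i))"
    proof (intro runs_Seq runs_weaken[OF loop[OF J i] order_refl])
      fix s2 assume "J i n s2"
      then show "runs (Assign ''i'' (Const 0) (Add (Var ''i'') (Const 1))) s2 1 (I (Suc i))"
        using nm by (auto simp: I_def J_def add.commute)
    qed
    then show "runs (Seq (Assign ''j'' (Const 0) (Const 0))
      (Seq (While (Less (Var ''j'') (Var N)) ?inner) (Assign ''i'' (Const 0) (Add (Var ''i'') (Const 1))))) s'
      (1 + ((n * ((2 + 2) + 1) + 1) + 1)) (I (Suc i))" by simp
  qed (use that in simp)
  let ?s0 = "s(''p'' := (s ''p'')(0 := 0), ''i'' := (s ''i'')(0 := 0))"
  have "I 0 ?s0" by (auto simp: I_def J_def)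
  from outer[OF this] have "runs (fill dst N b) s (fill_time n) (I n)"
    unfolding fill_def fill_time_def by simp
  then show ?thesis
  proof (rule runs_weaken)
    fix s' assume I: "I n s'"
    have "s' dst (i * n + j) = (if \<beta> i j then 1 else 0)" if "i < n" "j < n" for i j
    proof -
      have "i * n + j < Suc i * n" using that by simp
      also have "\<dots> \<le> n * n" using that by (intro mult_le_mono1) simp
      finally have "s' dst (i * n + j) = \<gamma> (i * n + j)" using I nm by (auto simp: I_def J_def)
      then show ?thesis using that by (simp add: \<gamma>_def)
    qed
    moreover have "agree_off {''p'', ''i'', ''j'', dst} s s'" using I by (simp add: I_def J_def)
    ultimately show "agree_off {''p'', ''i'', ''j'', dst} s s' \<and>
      (\<forall>i < s N 0. \<forall>j < s N 0. s' dst (i * s N 0 + j) = (if \<beta> i j then 1 else 0))"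
      unfolding n_def by blast
  qed (simp add: n_def)
qed

definition rows :: com where
  "rows = Seq (Assign ''p'' (Const 0) (Const 0)) (Seq (Assign ''i'' (Const 0) (Const 0))
     (While (Less (Var ''i'') (Var ''n''))
       (Seq (Assign ''cl'' (Var ''i'') (Var ''i'')) (Seq (Assign ''rw'' (Var ''i'') (Var ''p''))
         (Seq (Assign ''p'' (Const 0) (Add (Var ''p'') (Var ''n'')))
              (Assign ''i'' (Const 0) (Add (Var ''i'') (Const 1))))))))"

lemma runs_rows:
  "runs rows s (2 + (s ''n'' 0 * (4 + 1) + 1)) (\<lambda>s'. agree_off {''p'', ''i'', ''cl'', ''rw''} s s' \<and>
     (\<forall>q < s ''n'' 0. s' ''cl'' q = q \<and> s' ''rw'' q = q * s ''n'' 0))"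
proof -
  define n where "n = s ''n'' 0"
  define I where "I i s' \<longleftrightarrow> agree_off {''p'', ''i'', ''cl'', ''rw''} s s' \<and> s' ''i'' 0 = i \<and> s' ''p'' 0 = i * n \<and>
    (\<forall>q < i. s' ''cl'' q = q \<and> s' ''rw'' q = q * n)" for i s'
  have N: "s' ''n'' 0 = n" if "I i s'" for i s'
    using that agree_offD[of "{''p'', ''i'', ''cl'', ''rw''}" s s' "''n''"] by (auto simp: I_def n_def)
  let ?body = "Seq (Assign ''cl'' (Var ''i'') (Var ''i'')) (Seq (Assign ''rw'' (Var ''i'') (Var ''p''))
         (Seq (Assign ''p'' (Const 0) (Add (Var ''p'') (Var ''n'')))
              (Assign ''i'' (Const 0) (Add (Var ''i'') (Const 1)))))"
  let ?s0 = "s(''p'' := (s ''p'')(0 := 0), ''i'' := (s ''i'')(0 := 0))"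
  have "runs (While (Less (Var ''i'') (Var ''n'')) ?body) ?s0 (n * (4 + 1) + 1) (I n)"
  proof (rule runs_for)
    show "I 0 ?s0" by (simp add: I_def)
  next
    fix i s' assume I: "I i s'"
    then show "bval (Less (Var ''i'') (Var ''n'')) s' \<longleftrightarrow> i < n" using N[OF I] by (simp add: I_def)
  next
    fix i s' assume I: "I i s'"
    then show "runs ?body s' 4 (I (Suc i))" using N[OF I] by (simp add: I_def less_Suc_eq)
  qed
  then have "runs rows s (2 + (n * (4 + 1) + 1)) (I n)" by (simp add: rows_def)
  then show ?thesis unfolding n_def[symmetric] by (rule runs_weaken) (auto simp: I_def)
qed

lemma fill_time_mono: "a \<le> b \<Longrightarrow> fill_time a \<le> fill_time b"
  unfolding fill_time_def by (intro add_mono mult_le_mono order_refl)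

definition init :: com where
  "init = Seq rows (Seq (fill ''w'' ''n'' (Conj (Neg (Conj (Neg (Less (Var ''i'') (Var ''j''))) (Neg (Less (Var ''j'') (Var ''i'')))))
       (Less (Cell ''adj'' (Var ''p'')) (Const 1))))
     (Seq (Assign ''m'' (Const 0) (Var ''n'')) (Seq (Assign ''b'' (Const 0) (Var ''k''))
     (Seq (Assign ''no'' (Const 0) (Const 0)) (Assign ''go'' (Const 0) (Const 1))))))"

lemma runs_init:
  fixes G :: "nat ugraph"
  assumes G: "simple_graph G" and st: "stores s G vs k"
  shows "runs init s ((2 + (length vs * (4 + 1) + 1)) + (fill_time (length vs) + 4))
    (\<lambda>s'. step_inv (length vs) k (biclique_chain_completion G k) s' \<and> s' ''go'' 0 = 1 \<and>
      s' ''m'' 0 = length vs \<and> s' ''b'' 0 = k)"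
proof -
  define n where "n = length vs"
  define E where "E = vertex_pairs (verts G) - edges G"
  have d: "distinct vs" and set: "set vs = verts G" and sn: "s ''n'' 0 = n" and sk: "s ''k'' 0 = k"
    and adj: "\<And>i j. i < n \<Longrightarrow> j < n \<Longrightarrow> s ''adj'' (i * n + j) = (if {vs ! i, vs ! j} \<in> edges G then 1 else 0)"
    using st by (auto simp: stores_def n_def)
  have r: "runs rows s (2 + (n * (4 + 1) + 1)) (\<lambda>s'. agree_off {''p'', ''i'', ''cl'', ''rw''} s s' \<and>
     (\<forall>q < n. s' ''cl'' q = q \<and> s' ''rw'' q = q * n))" using runs_rows[of s] sn by simp
  show ?thesis unfolding init_def n_def[symmetric]
  proof (intro runs_Seq runs_weaken[OF r order_refl], elim conjE)
    fix s1 assume a1: "agree_off {''p'', ''i'', ''cl'', ''rw''} s s1" and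
      q1: "\<forall>q < n. s1 ''cl'' q = q \<and> s1 ''rw'' q = q * n"
    have e1: "s1 ''n'' = s ''n''" "s1 ''k'' = s ''k''" "s1 ''adj'' = s ''adj''"
      by (rule agree_offD[OF a1]; simp)+
    let ?b = "Conj (Neg (Conj (Neg (Less (Var ''i'') (Var ''j''))) (Neg (Less (Var ''j'') (Var ''i'')))))
       (Less (Cell ''adj'' (Var ''p'')) (Const 1))"
    have "runs (fill ''w'' ''n'' ?b) s1 (fill_time (s1 ''n'' 0)) (\<lambda>s'. agree_off {''p'', ''i'', ''j'', ''w''} s1 s' \<and>
      (\<forall>i < s1 ''n'' 0. \<forall>j < s1 ''n'' 0. s' ''w'' (i * s1 ''n'' 0 + j) = (if i \<noteq> j \<and> {vs ! i, vs ! j} \<notin> edges G then 1 else 0)))"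
    proof (rule runs_fill)
      fix s' i j assume a: "agree_off {''p'', ''i'', ''j'', ''w''} s1 s'" and *: "s' ''i'' 0 = i" "s' ''j'' 0 = j"
        "s' ''p'' 0 = i * s1 ''n'' 0 + j" "i < s1 ''n'' 0" "j < s1 ''n'' 0"
      have "s' ''adj'' = s ''adj''" using agree_offD[OF a, of "''adj''"] e1 by simp
      then show "bval ?b s' \<longleftrightarrow> i \<noteq> j \<and> {vs ! i, vs ! j} \<notin> edges G"
        using * adj e1 sn by auto
    qed auto
    then have f: "runs (fill ''w'' ''n'' ?b) s1 (fill_time n) (\<lambda>s'. agree_off {''p'', ''i'', ''j'', ''w''} s1 s' \<and>
      (\<forall>i < n. \<forall>j < n. s' ''w'' (i * n + j) = (if i \<noteq> j \<and> {vs ! i, vs ! j} \<notin> edges G then 1 else 0)))"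
      unfolding e1(1) sn .
    show "runs (fill ''w'' ''n'' ?b) s1 (fill_time n) (\<lambda>s2. runs (Seq (Assign ''m'' (Const 0) (Var ''n''))
      (Seq (Assign ''b'' (Const 0) (Var ''k''))
       (Seq (Assign ''no'' (Const 0) (Const 0)) (Assign ''go'' (Const 0) (Const 1))))) s2 4
      (\<lambda>s'. step_inv n k (biclique_chain_completion G k) s' \<and> s' ''go'' 0 = 1 \<and> s' ''m'' 0 = n \<and> s' ''b'' 0 = k))"
    proof (intro runs_weaken[OF f order_refl], elim conjE)
      fix s2 assume a2: "agree_off {''p'', ''i'', ''j'', ''w''} s1 s2"
        and w2: "\<forall>i < n. \<forall>j < n. s2 ''w'' (i * n + j) = (if i \<noteq> j \<and> {vs ! i, vs ! j} \<notin> edges G then 1 else 0)"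
      have e2: "s2 ''n'' = s1 ''n''" "s2 ''k'' = s1 ''k''" "s2 ''cl'' = s1 ''cl''" "s2 ''rw'' = s1 ''rw''"
        by (rule agree_offD[OF a2]; simp)+
      let ?s3 = "s2(''m'' := (s2 ''m'')(0 := n), ''b'' := (s2 ''b'')(0 := k), ''no'' := (s2 ''no'')(0 := 0),
        ''go'' := (s2 ''go'')(0 := 1))"
      have mem: "{vs ! i, vs ! j} \<in> E \<longleftrightarrow> i \<noteq> j \<and> {vs ! i, vs ! j} \<notin> edges G" if "i < n" "j < n" for i j
        using that d set nth_mem[of i vs] nth_mem[of j vs] by (auto simp: E_def n_def nth_eq_iff_index_eq)
      have "rep n E vs ?s3"
        unfolding rep_def n_def[symmetric] using d q1 e2 w2 mem
        by (auto simp: E_def set inj_on_def n_def)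
      then have "reducing n k (biclique_chain_completion G k) E vs ?s3"
        using biclique_chain_completion_iff[OF G] by (simp add: reducing_def E_def)
      then have "step_inv n k (biclique_chain_completion G k) ?s3"
        unfolding step_inv_def by (intro exI[of _ E] exI[of _ vs]) simp
      then show "runs (Seq (Assign ''m'' (Const 0) (Var ''n'')) (Seq (Assign ''b'' (Const 0) (Var ''k''))
       (Seq (Assign ''no'' (Const 0) (Const 0)) (Assign ''go'' (Const 0) (Const 1))))) s2 4
      (\<lambda>s'. step_inv n k (biclique_chain_completion G k) s' \<and> s' ''go'' 0 = 1 \<and> s' ''m'' 0 = n \<and> s' ''b'' 0 = k)"
        using e1 e2 sn sk by simp
    qed
  qed
qed

definition good_output :: "nat \<Rightarrow> nat \<Rightarrow> bool \<Rightarrow> state \<Rightarrow> bool" where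
  "good_output n k A s \<longleftrightarrow> (\<exists>(G :: nat ugraph) vs k'. stores s G vs k' \<and> simple_graph G \<and> 0 < k' \<and> k' \<le> k \<and>
     (A \<longleftrightarrow> biclique_chain_completion G k') \<and> card (verts G) \<le> 28 * (k * k) \<and> card (verts G) \<le> n + 4)"

definition out_yes :: com where
  "out_yes = Seq (Assign ''n'' (Const 0) (Const 0)) (Assign ''k'' (Const 0) (Const 1))"

definition out_no :: com where
  "out_no = Seq (Assign ''m'' (Const 0) (Const 4)) (Seq (fill ''adj'' ''m'' (Less (Const 0) (Const 0)))
     (Seq (Assign ''n'' (Const 0) (Const 4)) (Assign ''k'' (Const 0) (Const 1))))"

definition out_graph :: com where
  "out_graph = Seq (fill ''adj'' ''m''
      (Conj (Neg (Conj (Neg (Less (Var ''i'') (Var ''j''))) (Neg (Less (Var ''j'') (Var ''i'')))))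
        (Less (Cell ''w'' (Add (Cell ''rw'' (Var ''i'')) (Cell ''cl'' (Var ''j'')))) (Const 1))))
     (Seq (Assign ''n'' (Const 0) (Var ''m'')) (Assign ''k'' (Const 0) (Var ''b'')))"

lemma runs_out_yes:
  assumes "0 < k" "A" shows "runs out_yes s 2 (good_output n k A)"
proof -
  let ?s = "s(''n'' := (s ''n'')(0 := 0), ''k'' := (s ''k'')(0 := 1))"
  have "stores ?s ({}, {}) [] 1" by (simp add: stores_def)
  moreover have "biclique_chain_completion (({}, {}) :: nat ugraph) 1"
    by (subst biclique_chain_completion_iff)
      (auto simp: simple_graph_def vertex_pairs_def chain_deletion_def chain_edges_def)
  ultimately have "good_output n k A ?s" unfolding good_output_def
    using assms by (intro exI[of _ "({}, {})"] exI[of _ "[]"] exI[of _ 1]) (simp add: simple_graph_def)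
  then show ?thesis by (simp add: out_yes_def)
qed

lemma runs_out_no:
  assumes "0 < k" "\<not> A" shows "runs out_no s (1 + (fill_time 4 + 2)) (good_output n k A)"
proof -
  let ?s = "s(''m'' := (s ''m'')(0 := 4))"
  have f: "runs (fill ''adj'' ''m'' (Less (Const 0) (Const 0))) ?s (fill_time (?s ''m'' 0))
     (\<lambda>s'. agree_off {''p'', ''i'', ''j'', ''adj''} ?s s' \<and>
       (\<forall>i < ?s ''m'' 0. \<forall>j < ?s ''m'' 0. s' ''adj'' (i * ?s ''m'' 0 + j) = (if False then 1 else 0)))"
    by (rule runs_fill) auto
  have "runs (Seq (fill ''adj'' ''m'' (Less (Const 0) (Const 0)))
     (Seq (Assign ''n'' (Const 0) (Const 4)) (Assign ''k'' (Const 0) (Const 1)))) ?s (fill_time (?s ''m'' 0) + 2) (good_output n k A)"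
  proof (intro runs_Seq runs_weaken[OF f order_refl], elim conjE)
    fix s2 :: state assume z: "\<forall>i < ?s ''m'' 0. \<forall>j < ?s ''m'' 0. s2 ''adj'' (i * ?s ''m'' 0 + j) = (if False then 1 else 0)"
    let ?s3 = "s2(''n'' := (s2 ''n'')(0 := 4), ''k'' := (s2 ''k'')(0 := 1))"
    let ?G = "({0, 1, 2, 3}, {}) :: nat ugraph"
    have "{0..<4} = {0, 1, 2, 3 :: nat}" by auto
    then have "stores ?s3 ?G [0..<4] 1" unfolding stores_def using z by simp
    moreover have "simple_graph ?G" by (simp add: simple_graph_def)
    moreover have "\<not> biclique_chain_completion ?G 1"
      using biclique_chain_completion_iff[of ?G 1] \<open>simple_graph ?G\<close> not_chain_deletion_K4 by simp
    moreover have c: "card (verts ?G) = 4" by simp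
    moreover have "0 < k * k" using assms(1) by simp
    then have "card (verts ?G) \<le> 28 * (k * k)" unfolding c by linarith
    moreover have "1 \<le> k" "card (verts ?G) \<le> n + 4" using assms(1) c by simp_all
    ultimately have "good_output n k A ?s3" unfolding good_output_def
      using assms(2) zero_less_one by blast
    then show "runs (Seq (Assign ''n'' (Const 0) (Const 4)) (Assign ''k'' (Const 0) (Const 1))) s2 2 (good_output n k A)"
      by simp
  qed
  then show ?thesis by (simp add: out_no_def)
qed

lemma runs_out_graph:
  fixes E :: "nat set set"
  assumes r: "rep n E ws s" and b: "0 < s ''b'' 0" "s ''b'' 0 \<le> k"
    and A: "A \<longleftrightarrow> chain_deletion E (s ''b'' 0)" and m: "s ''m'' 0 \<le> 28 * (s ''b'' 0 * s ''b'' 0)"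
  shows "runs out_graph s (fill_time n + 2) (good_output n k A)"
proof -
  have E: "E \<subseteq> vertex_pairs (set ws)" and d: "distinct ws" and mw: "s ''m'' 0 = length ws" and ln: "length ws \<le> n"
    and rw: "\<And>i. i < length ws \<Longrightarrow> s ''rw'' i = s ''cl'' i * n"
    and w: "\<And>i j. i < length ws \<Longrightarrow> j < length ws \<Longrightarrow>
      s ''w'' (s ''cl'' i * n + s ''cl'' j) = (if {ws ! i, ws ! j} \<in> E then 1 else 0)"
    using r by (auto simp: rep_def)
  let ?b = "Conj (Neg (Conj (Neg (Less (Var ''i'') (Var ''j''))) (Neg (Less (Var ''j'') (Var ''i'')))))
        (Less (Cell ''w'' (Add (Cell ''rw'' (Var ''i'')) (Cell ''cl'' (Var ''j'')))) (Const 1))"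
  have f: "runs (fill ''adj'' ''m'' ?b) s (fill_time (s ''m'' 0))
     (\<lambda>s'. agree_off {''p'', ''i'', ''j'', ''adj''} s s' \<and>
       (\<forall>i < s ''m'' 0. \<forall>j < s ''m'' 0. s' ''adj'' (i * s ''m'' 0 + j) = (if i \<noteq> j \<and> {ws ! i, ws ! j} \<notin> E then 1 else 0)))"
  proof (rule runs_fill)
    fix s' i j assume a: "agree_off {''p'', ''i'', ''j'', ''adj''} s s'" and *: "s' ''i'' 0 = i" "s' ''j'' 0 = j"
      "i < s ''m'' 0" "j < s ''m'' 0"
    have "s' ''w'' = s ''w''" "s' ''rw'' = s ''rw''" "s' ''cl'' = s ''cl''" by (rule agree_offD[OF a]; simp)+
    then show "bval ?b s' \<longleftrightarrow> i \<noteq> j \<and> {ws ! i, ws ! j} \<notin> E" using * w rw mw by auto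
  qed auto
  have "runs out_graph s (fill_time (s ''m'' 0) + 2) (good_output n k A)"
    unfolding out_graph_def
  proof (intro runs_Seq runs_weaken[OF f order_refl], elim conjE)
    fix s2 assume a2: "agree_off {''p'', ''i'', ''j'', ''adj''} s s2"
      and z: "\<forall>i < s ''m'' 0. \<forall>j < s ''m'' 0. s2 ''adj'' (i * s ''m'' 0 + j) = (if i \<noteq> j \<and> {ws ! i, ws ! j} \<notin> E then 1 else 0)"
    have e: "s2 ''m'' = s ''m''" "s2 ''b'' = s ''b''" by (rule agree_offD[OF a2]; simp)+
    let ?s3 = "s2(''n'' := (s2 ''n'')(0 := length ws), ''k'' := (s2 ''k'')(0 := s ''b'' 0))"
    let ?G = "(set ws, vertex_pairs (set ws) - E)"
    have "stores ?s3 ?G ws (s ''b'' 0)"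
      unfolding stores_def using z d by (auto simp: mw nth_eq_iff_index_eq)
    moreover have sg: "simple_graph ?G" by (auto simp: simple_graph_def)
    moreover have "vertex_pairs (set ws) - (vertex_pairs (set ws) - E) = E" using E by blast
    then have "A \<longleftrightarrow> biclique_chain_completion ?G (s ''b'' 0)"
      using biclique_chain_completion_iff[OF sg] A by simp
    moreover have "card (set ws) = length ws" using d by (rule distinct_card)
    moreover have "28 * (s ''b'' 0 * s ''b'' 0) \<le> 28 * (k * k)" using b(2) by (intro mult_le_mono order_refl)
    ultimately have "good_output n k A ?s3" unfolding good_output_def
      using b m mw ln by (intro exI[of _ ?G] exI[of _ ws] exI[of _ "s ''b'' 0"]) simp
    then show "runs (Seq (Assign ''n'' (Const 0) (Var ''m'')) (Assign ''k'' (Const 0) (Var ''b''))) s2 2 (good_output n k A)"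
      using e mw by simp
  qed
  then show ?thesis using fill_time_mono[OF ln] mw by (elim runs_weaken) auto
qed

primrec times_const :: "nat \<Rightarrow> aexp \<Rightarrow> aexp" where
  "times_const 0 a = Const 0"
| "times_const (Suc c) a = Add a (times_const c a)"

lemma aval_times_const [simp]: "aval (times_const c a) s = c * aval a s"
  by (induction c) auto

definition square :: com where
  "square = Seq (Assign ''q'' (Const 0) (Const 0)) (Seq (Assign ''i'' (Const 0) (Const 0))
     (While (Less (Var ''i'') (Var ''b'')) (Seq (Assign ''q'' (Const 0) (Add (Var ''q'') (Var ''b'')))
       (Assign ''i'' (Const 0) (Add (Var ''i'') (Const 1))))))"

lemma runs_square:
  "runs square s (2 + (s ''b'' 0 * (2 + 1) + 1)) (\<lambda>s'. agree_off {''q'', ''i''} s s' \<and> s' ''q'' 0 = s ''b'' 0 * s ''b'' 0)"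
proof -
  define b where "b = s ''b'' 0"
  define I where "I i s' \<longleftrightarrow> agree_off {''q'', ''i''} s s' \<and> s' ''i'' 0 = i \<and> s' ''q'' 0 = i * b" for i s'
  have B: "s' ''b'' 0 = b" if "I i s'" for i s'
    using that agree_offD[of "{''q'', ''i''}" s s' "''b''"] by (auto simp: I_def b_def)
  let ?s0 = "s(''q'' := (s ''q'')(0 := 0), ''i'' := (s ''i'')(0 := 0))"
  have "runs (While (Less (Var ''i'') (Var ''b'')) (Seq (Assign ''q'' (Const 0) (Add (Var ''q'') (Var ''b'')))
       (Assign ''i'' (Const 0) (Add (Var ''i'') (Const 1))))) ?s0 (b * (2 + 1) + 1) (I b)"
  proof (rule runs_for)
    show "I 0 ?s0" by (simp add: I_def)
  next
    fix i s' assume I: "I i s'"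
    then show "bval (Less (Var ''i'') (Var ''b'')) s' \<longleftrightarrow> i < b" using B[OF I] by (simp add: I_def)
  next
    fix i s' assume I: "I i s'"
    then show "runs (Seq (Assign ''q'' (Const 0) (Add (Var ''q'') (Var ''b'')))
       (Assign ''i'' (Const 0) (Add (Var ''i'') (Const 1)))) s' 2 (I (Suc i))"
      using B[OF I] by (simp add: I_def)
  qed
  then have "runs square s (2 + (b * (2 + 1) + 1)) (I b)" by (simp add: square_def)
  then show ?thesis unfolding b_def[symmetric] by (rule runs_weaken) (auto simp: I_def)
qed

definition finish :: com where
  "finish = Cond (Less (Const 0) (Var ''no'')) out_no (Cond (Less (Var ''b'') (Const 1)) out_yes
     (Seq square (Cond (Less (times_const 28 (Var ''q'')) (Var ''m'')) out_no out_graph)))"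

definition finish_time :: "nat \<Rightarrow> nat" where
  "finish_time n = (2 + (n * (2 + 1) + 1)) + (fill_time (n + 4) + 3 + 1) + 1 + 1"

lemma runs_finish:
  assumes inv: "step_inv n k A s" and go: "s ''go'' 0 = 0" and k: "0 < k" "k \<le> n"
  shows "runs finish s (finish_time n) (good_output n k A)"
proof -
  obtain E ws where red: "reducing n k A E ws s" and rd: "s ''no'' 0 = 0 \<Longrightarrow> reduced E ws s"
    using inv go by (auto simp: step_inv_def)
  have rep: "rep n E ws s" and bk: "s ''b'' 0 \<le> k" using red by (auto simp: reducing_def)
  have E: "E \<subseteq> vertex_pairs (set ws)" and d: "distinct ws" and m: "s ''m'' 0 = length ws"
    using rep by (auto simp: rep_def)
  have ft: "fill_time 4 \<le> fill_time (n + 4)" "fill_time n \<le> fill_time (n + 4)"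
    by (intro fill_time_mono; simp)+
  have no: "runs out_no s' (fill_time (n + 4) + 3) (good_output n k A)" if "\<not> A" for s'
    by (rule runs_weaken[OF runs_out_no[OF k(1) that, of _ n]]) (use ft in auto)
  show ?thesis unfolding finish_def finish_time_def
  proof (intro runs_CondI)
    assume "bval (Less (Const 0) (Var ''no'')) s"
    then have "\<not> A" using red by (auto simp: reducing_def)
    then show "runs out_no s ((2 + (n * (2 + 1) + 1)) + (fill_time (n + 4) + 3 + 1) + 1) (good_output n k A)"
      using no by (elim runs_weaken[OF no]) auto
  next
    assume "\<not> bval (Less (Const 0) (Var ''no'')) s" and b0: "bval (Less (Var ''b'') (Const 1)) s"
    then have n0: "s ''no'' 0 = 0" by simp
    have "\<not> conflict E z w x" if zw: "{z, w} \<in> E" and x: "x \<in> set ws" for z w x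
    proof
      assume c: "conflict E z w x"
      then have "{x \<in> set ws. conflict E z w x} \<noteq> {}" using x by blast
      then have "0 < card {x \<in> set ws. conflict E z w x}" by (simp add: card_gt_0_iff)
      then have "forced_edge E (set ws) (s ''b'' 0) z w" using zw b0 by (simp add: forced_edge_def)
      then show False using rd[OF n0] vertex_pairs_edgeD(1,2)[OF E zw] by (auto simp: reduced_def)
    qed
    then have "chain_edges E" by (intro chain_edges_if_conflict_free[OF E]) auto
    then have "chain_deletion E (s ''b'' 0)" unfolding chain_deletion_def by (intro exI[of _ "{}"]) simp
    then have A: "A" using red n0 by (simp add: reducing_def)
    show "runs out_yes s ((2 + (n * (2 + 1) + 1)) + (fill_time (n + 4) + 3 + 1)) (good_output n k A)"
      by (rule runs_weaken[OF runs_out_yes[OF k(1) A]]) auto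
  next
    assume "\<not> bval (Less (Const 0) (Var ''no'')) s" and "\<not> bval (Less (Var ''b'') (Const 1)) s"
    then have n0: "s ''no'' 0 = 0" and b0: "0 < s ''b'' 0" by auto
    have A: "A \<longleftrightarrow> chain_deletion E (s ''b'' 0)" using red n0 by (simp add: reducing_def)
    have sq: "runs square s (2 + (n * (2 + 1) + 1)) (\<lambda>s'. agree_off {''q'', ''i''} s s' \<and> s' ''q'' 0 = s ''b'' 0 * s ''b'' 0)"
      by (rule runs_weaken[OF runs_square]) (use bk k in auto)
    show "runs (Seq square (Cond (Less (times_const 28 (Var ''q'')) (Var ''m'')) out_no out_graph)) s
      ((2 + (n * (2 + 1) + 1)) + (fill_time (n + 4) + 3 + 1)) (good_output n k A)"
    proof (intro runs_Seq runs_weaken[OF sq order_refl], elim conjE)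
      fix s2 assume a2: "agree_off {''q'', ''i''} s s2" and q: "s2 ''q'' 0 = s ''b'' 0 * s ''b'' 0"
      have e: "s2 ''m'' = s ''m''" "s2 ''b'' = s ''b''" "s2 ''cl'' = s ''cl''" "s2 ''rw'' = s ''rw''" "s2 ''w'' = s ''w''"
        by (rule agree_offD[OF a2]; simp)+
      have rep2: "rep n E ws s2" using rep rep_cong[of s2 s n E ws] e by simp
      show "runs (Cond (Less (times_const 28 (Var ''q'')) (Var ''m'')) out_no out_graph) s2 (fill_time (n + 4) + 3 + 1)
        (good_output n k A)"
      proof (rule runs_CondI)
        assume "bval (Less (times_const 28 (Var ''q'')) (Var ''m'')) s2"
        then have big: "28 * (s ''b'' 0 * s ''b'' 0) < card (set ws)"
          using q e m distinct_card[OF d] by simp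
        have "\<not> A"
        proof
          assume A' : A
          have "card (set ws) \<le> 28 * (s ''b'' 0 * s ''b'' 0)"
            by (rule reduced_card_le[OF E _ _ b0]) (use A A' rd[OF n0] in \<open>auto simp: reduced_def\<close>)
          then show False using big by simp
        qed
        then show "runs out_no s2 (fill_time (n + 4) + 3) (good_output n k A)" by (rule no)
      next
        assume nb: "\<not> bval (Less (times_const 28 (Var ''q'')) (Var ''m'')) s2"
        have "runs out_graph s2 (fill_time n + 2) (good_output n k A)"
          by (rule runs_out_graph[OF rep2]) (use b0 bk A nb e q in auto)
        then show "runs out_graph s2 (fill_time (n + 4) + 3) (good_output n k A)"
          using ft by (elim runs_weaken) auto
      qed
    qed
  qed
qed

text \<open>
  If \<open>n \<le> k\<close> the instance is already small enough.  Otherwise \<open>k < n\<close>, so loops up to \<open>k\<close> are polynomial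
  in the input size although \<open>k\<close> is written in binary.
\<close>

definition kernelize :: com where
  "kernelize = Cond (Less (Var ''k'') (Var ''n''))
     (Seq init (Seq (While (Less (Const 0) (Var ''go'')) step) finish)) Skip"

definition kernelize_time :: "nat \<Rightarrow> nat" where
  "kernelize_time n = ((2 + (n * (4 + 1) + 1)) + (fill_time n + 4)) +
     (((1 + n + n) * (step_time n + 1) + 1) + finish_time n) + 1"

lemma runs_kernelize:
  fixes G :: "nat ugraph"
  assumes G: "simple_graph G" and st: "stores s G vs k" and k: "0 < k" "k < length vs"
  shows "runs kernelize s (kernelize_time (length vs)) (good_output (length vs) k (biclique_chain_completion G k))"
proof -
  define n where "n = length vs"
  let ?A = "biclique_chain_completion G k"
  have sn: "s ''n'' 0 = n" "s ''k'' 0 = k" using st by (auto simp: stores_def n_def)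
  have loop: "runs (While (Less (Const 0) (Var ''go'')) step) s1 ((1 + n + n) * (step_time n + 1) + 1)
      (\<lambda>s'. (step_inv n k ?A s' \<and> s' ''go'' 0 \<le> 1) \<and> \<not> bval (Less (Const 0) (Var ''go'')) s')"
    if s1: "step_inv n k ?A s1 \<and> s1 ''go'' 0 = 1 \<and> s1 ''m'' 0 = n \<and> s1 ''b'' 0 = k" for s1
  proof (rule runs_While[where \<mu> = "\<lambda>s. s ''go'' 0 + s ''m'' 0 + s ''b'' 0"])
    fix s2 assume "step_inv n k ?A s2 \<and> s2 ''go'' 0 \<le> 1" "bval (Less (Const 0) (Var ''go'')) s2"
    then have i: "step_inv n k ?A s2" and g: "s2 ''go'' 0 = 1" by auto
    show "runs step s2 (step_time n) (\<lambda>s'. (step_inv n k ?A s' \<and> s' ''go'' 0 \<le> 1) \<and>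
      s' ''go'' 0 + s' ''m'' 0 + s' ''b'' 0 < s2 ''go'' 0 + s2 ''m'' 0 + s2 ''b'' 0)"
      by (rule runs_weaken[OF runs_step[OF i g] order_refl]) (auto simp: step_inv_def reducing_def)
  qed (use s1 k n_def in auto)
  have "runs (Seq init (Seq (While (Less (Const 0) (Var ''go'')) step) finish)) s
     (((2 + (n * (4 + 1) + 1)) + (fill_time n + 4)) + (((1 + n + n) * (step_time n + 1) + 1) + finish_time n))
     (good_output n k ?A)"
  proof (intro runs_Seq runs_weaken[OF runs_init[OF G st, folded n_def] order_refl])
    fix s1 assume "step_inv n k ?A s1 \<and> s1 ''go'' 0 = 1 \<and> s1 ''m'' 0 = n \<and> s1 ''b'' 0 = k"
    from loop[OF this] show "runs (While (Less (Const 0) (Var ''go'')) step) s1 ((1 + n + n) * (step_time n + 1) + 1)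
      (\<lambda>s'. runs finish s' (finish_time n) (good_output n k ?A))"
      by (rule runs_weaken[OF _ order_refl]) (use k in \<open>auto intro!: runs_finish simp: n_def\<close>)
  qed
  then show ?thesis
    unfolding kernelize_def kernelize_time_def n_def[symmetric] using sn k n_def by (intro runs_CondI) auto
qed

lemma poly_bounded_kernelize_time: "poly_bounded kernelize_time"
  unfolding kernelize_time_def[abs_def] finish_time_def fill_time_def step_time_def search_time_def
  by (intro poly_bounded_intros poly_bounded_ctime)

theorem theorem4:
  "\<exists>h :: nat \<Rightarrow> nat. (\<lambda>k. real (h k)) \<in> O(\<lambda>k. real k ^ 2) \<and>
     admits_kernel biclique_chain_completion h"
proof (intro exI conjI)
  show "(\<lambda>k. real (28 * (k * k))) \<in> O(\<lambda>k. real k ^ 2)"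
    by (rule bigoI[of _ 28]) (simp add: power2_eq_square)
next
  obtain c d where cd: "\<And>n. kernelize_time n \<le> c * (n + 1) ^ d"
    using poly_bounded_kernelize_time unfolding poly_bounded_def by blast
  define D where "D = d + 1"
  define C where "C = (c + 36) * 2 ^ D"
  have bound: "T + S \<le> C * I ^ D + C"
    if T: "T \<le> c * (n + 1) ^ d + 2" and n: "n \<le> I" and S: "S \<le> 9 * I + 16" for T S n I :: nat
  proof -
    have "(n + 1) ^ d \<le> (I + 1) ^ D"
      using n by (intro order_trans[OF power_mono[of "n + 1" "I + 1" d] power_increasing]) (auto simp: D_def)
    then have "c * (n + 1) ^ d \<le> c * (I + 1) ^ D" by (rule mult_le_mono2)
    moreover have "I + 1 \<le> (I + 1) ^ D" using power_increasing[of 1 D "I + 1"] by (simp add: D_def)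
    ultimately have "T + S \<le> c * (I + 1) ^ D + 36 * (I + 1) ^ D" using T S by linarith
    also have "\<dots> = (c + 36) * (I + 1) ^ D" by (simp add: add_mult_distrib)
    also have "(I + 1) ^ D \<le> 2 ^ D * I ^ D + 2 ^ D"
    proof (cases "I = 0")
      case False
      then have "(I + 1) ^ D \<le> (2 * I) ^ D" by (intro power_mono) auto
      then show ?thesis by (simp add: power_mult_distrib)
    qed (simp add: Suc_le_eq)
    then have "(c + 36) * (I + 1) ^ D \<le> (c + 36) * (2 ^ D * I ^ D + 2 ^ D)" by (rule mult_le_mono2)
    also have "\<dots> = C * I ^ D + C" by (simp add: C_def algebra_simps)
    finally show ?thesis .
  qed
  show "admits_kernel biclique_chain_completion (\<lambda>k. 28 * (k * k))" unfolding admits_kernel_def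
  proof (rule exI[of _ kernelize], rule exI[of _ C], rule exI[of _ D], intro allI impI)
    fix G :: "nat ugraph" and vs k s
    assume "simple_graph G \<and> 0 < k \<and> stores s G vs k \<and> clean s"
    then have G: "simple_graph G" and k: "0 < k" and st: "stores s G vs k" by auto
    have card: "card (verts G) = length vs" using st distinct_card by (fastforce simp: stores_def)
    have n: "length vs \<le> inst_size G k"
      unfolding inst_size_def card using self_le_power[of "length vs" 2] by (cases "length vs = 0") auto
    show "\<exists>t s' (G' :: nat ugraph) vs' k'. exec kernelize s t s' \<and> stores s' G' vs' k' \<and>
          t + inst_size G' k' \<le> C * inst_size G k ^ D + C \<and> simple_graph G' \<and> 0 < k' \<and>
          (biclique_chain_completion G k \<longleftrightarrow> biclique_chain_completion G' k') \<and> k' \<le> k \<and>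
          card (verts G') \<le> 28 * (k * k)"
    proof (cases "k < length vs")
      case True
      from runs_kernelize[OF G st k True] obtain t s' vs' k' and G' :: "nat ugraph" where
        *: "exec kernelize s t s'" "t \<le> kernelize_time (length vs)" "stores s' G' vs' k'" "simple_graph G'"
        "0 < k'" "k' \<le> k" "biclique_chain_completion G k \<longleftrightarrow> biclique_chain_completion G' k'"
        "card (verts G') \<le> 28 * (k * k)" "card (verts G') \<le> length vs + 4"
        unfolding runs_def good_output_def by blast
      have "card (verts G') ^ 2 \<le> (length vs + 4) ^ 2" using *(9) by (intro power_mono) auto
      also have "\<dots> = length vs ^ 2 + 8 * length vs + 16" by (simp add: power2_eq_square algebra_simps)
      finally have sq: "card (verts G') ^ 2 \<le> length vs ^ 2 + 8 * length vs + 16" .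
      have "x + y \<le> 9 * (a + z) + 16" if "x \<le> a + 8 * l + 16" "y \<le> z" "l \<le> a + z" for x y z a l :: nat
        using that by simp
      from this[OF sq floorlog_mono[OF *(6)]] have "inst_size G' k' \<le> 9 * inst_size G k + 16"
        using n unfolding inst_size_def card by blast
      moreover have "t \<le> c * (length vs + 1) ^ d + 2" using *(2) cd[of "length vs"] by linarith
      ultimately have "t + inst_size G' k' \<le> C * inst_size G k ^ D + C" using n by (intro bound)
      then show ?thesis using * by blast
    next
      case False
      then have "exec kernelize s 2 s"
        using exec.CondFalse[OF _ exec.Skip] st by (auto simp: kernelize_def stores_def numeral_2_eq_2)
      moreover have "2 + inst_size G k \<le> C * inst_size G k ^ D + C" using n by (intro bound) auto
      moreover have "k \<le> 28 * (k * k)" using k by simp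
      then have "card (verts G) \<le> 28 * (k * k)" using False card by linarith
      ultimately show ?thesis using G k st by blast
    qed
  qed
qed

end
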